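(* Let $k$ be a field, $r\ge 1$, and let $\mathcal X\subset\mathbb Z^r$ be a Cubist subset. Then there is an isomorphism of graded algebras $V_{\mathcal X}^!\cong U_{\mathcal X}$; in other words, $U_{\mathcal X}$ is Koszul dual to $V_{\mathcal X}$.
   Context: $\epsilon_1,\dots,\epsilon_r$ is the standard basis of $\mathbb Z^r$; $x\le y$ means $y-x$ has nonnegative coordinates; $x[n]=x+n(\epsilon_1+\cdots+\epsilon_r)$. A subset $\mathcal X\subset\mathbb Z^r$ is Cubist if $\mathcal X=\mathcal X^-\setminus\mathcal X^-[-1]$ for some nonempty proper ideal (down-closed subset) $\mathcal X^-$ of $(\mathbb Z^r,\le)$. Paths in quivers are composed from left to right; arrows have degree 1. $U_r$ is the $k$-algebra given by the quiver with vertices (idempotents) $e_x$, $x\in\mathbb Z^r$, arrows $a_{x,i}$ from $x$ to $x+\epsilon_i$ and $b_{x,i}$ from $x$ to $x-\epsilon_i$ ($1\le i\le r$), with relations, for all $x$: $a_{x,i}a_{x+\epsilon_i,i}=0$ and $b_{x,i}b_{x-\epsilon_i,i}=0$; for $i\neq j$: $a_{x,i}a_{x+\epsilon_i,j}+a_{x,j}a_{x+\epsilon_j,i}=0$, $b_{x,i}b_{x-\epsilon_i,j}+b_{x,j}b_{x-\epsilon_j,i}=0$, $a_{x,i}b_{x+\epsilon_i,j}+b_{x,j}a_{x-\epsilon_j,i}=0$; and for $1\le i<r$: $b_{x,i}a_{x-\epsilon_i,i}+a_{x,i}b_{x+\epsilon_i,i}=b_{x,i+1}a_{x-\epsilon_{i+1},i+1}+a_{x,i+1}b_{x+\epsilon_{i+1},i+1}$.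 Put $U_{\mathcal X}=U_r/\sum_{x\in\mathbb Z^r\setminus\mathcal X}U_re_xU_r$. $V_r$ is the $k$-algebra given by the quiver with vertices (idempotents) $f_x$, $x\in\mathbb Z^r$, arrows $\alpha_{x,i}$ from $x$ to $x+\epsilon_i$ and $\beta_{x,i}$ from $x$ to $x-\epsilon_i$ ($1\le i\le r$), with relations, for all $x$: $\alpha_{x,i}\alpha_{x+\epsilon_i,j}=\alpha_{x,j}\alpha_{x+\epsilon_j,i}$ and $\beta_{x,i}\beta_{x-\epsilon_i,j}=\beta_{x,j}\beta_{x-\epsilon_j,i}$ for $i\ne j$; $\alpha_{x,i}\beta_{x+\epsilon_i,j}=\beta_{x,j}\alpha_{x-\epsilon_j,i}$ for all $1\le i,j\le r$; and $\sum_{i=1}^r\beta_{x,i}\alpha_{x-\epsilon_i,i}=0$. Put $V_{\mathcal X}=\sum_{x,y\in\mathcal X}f_xV_rf_y$. $V_{\mathcal X}$ is a Koszul (hence quadratic) algebra over its degree zero part, which has basis $\{f_x:x\in\mathcal X\}$. $V_{\mathcal X}^!$ denotes its quadratic dual (given by the same quiver, with degree-two relations the orthogonal complement of those of $V_{\mathcal X}$), which for a Koszul algebra is the Koszul dual. *)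

theory Defs
  imports
    "HOL-Library.Poly_Mapping"
    "Graph_Theory.Arc_Walk"
    "Graph_Theory.Digraph_Component"
begin

section \<open>Graded algebras without unit\<close>

text \<open>
  The algebras below have infinitely many vertex idempotents and hence in general no unit element,
  so the unital structures of HOL-Algebra do not apply.
\<close>

record ('k, 'm) graded_alg =
  gcarrier :: "'m set"
  gzero :: 'm
  gadd :: "'m \<Rightarrow> 'm \<Rightarrow> 'm"
  gmult :: "'m \<Rightarrow> 'm \<Rightarrow> 'm"
  gscale :: "'k \<Rightarrow> 'm \<Rightarrow> 'm"
  gdeg :: "nat \<Rightarrow> 'm set"

definition graded_hom ::
  "('k, 'm) graded_alg \<Rightarrow> ('k, 'n) graded_alg \<Rightarrow> ('m \<Rightarrow> 'n) \<Rightarrow> bool" where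
  "graded_hom A B h \<longleftrightarrow>
     h ` gcarrier A \<subseteq> gcarrier B \<and>
     h (gzero A) = gzero B \<and>
     (\<forall>x \<in> gcarrier A. \<forall>y \<in> gcarrier A.
        h (gadd A x y) = gadd B (h x) (h y) \<and> h (gmult A x y) = gmult B (h x) (h y)) \<and>
     (\<forall>c. \<forall>x \<in> gcarrier A. h (gscale A c x) = gscale B c (h x)) \<and>
     (\<forall>n. h ` gdeg A n \<subseteq> gdeg B n)"

definition graded_isomorphic ::
  "('k, 'm) graded_alg \<Rightarrow> ('k, 'n) graded_alg \<Rightarrow> bool" where
  "graded_isomorphic A B \<longleftrightarrow>
     (\<exists>h. graded_hom A B h \<and> bij_betw h (gcarrier A) (gcarrier B) \<and>
          (\<forall>n. h ` gdeg A n = gdeg B n))"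

inductive_set lin_span :: "('k, 'm) graded_alg \<Rightarrow> 'm set \<Rightarrow> 'm set"
  for A S where
  zero: "gzero A \<in> lin_span A S"
| base: "s \<in> S \<Longrightarrow> s \<in> lin_span A S"
| add: "x \<in> lin_span A S \<Longrightarrow> y \<in> lin_span A S \<Longrightarrow> gadd A x y \<in> lin_span A S"
| scale: "x \<in> lin_span A S \<Longrightarrow> gscale A c x \<in> lin_span A S"

inductive_set ideal_gen :: "('k, 'm) graded_alg \<Rightarrow> 'm set \<Rightarrow> 'm set"
  for A S where
  zero: "gzero A \<in> ideal_gen A S"
| base: "s \<in> S \<Longrightarrow> s \<in> ideal_gen A S"
| add: "x \<in> ideal_gen A S \<Longrightarrow> y \<in> ideal_gen A S \<Longrightarrow> gadd A x y \<in> ideal_gen A S"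
| scale: "x \<in> ideal_gen A S \<Longrightarrow> gscale A c x \<in> ideal_gen A S"
| left: "a \<in> gcarrier A \<Longrightarrow> x \<in> ideal_gen A S \<Longrightarrow> gmult A a x \<in> ideal_gen A S"
| right: "a \<in> gcarrier A \<Longrightarrow> x \<in> ideal_gen A S \<Longrightarrow> gmult A x a \<in> ideal_gen A S"

definition coset :: "('k, 'm) graded_alg \<Rightarrow> 'm set \<Rightarrow> 'm \<Rightarrow> 'm set" where
  "coset A I x = gadd A x ` I"

text \<open>
  As for cosets in HOL-Algebra, the operations are unions over representatives;
  when \<open>I\<close> is an ideal every member of such a union is the same coset.
\<close>

definition quotient_alg ::
  "('k, 'm) graded_alg \<Rightarrow> 'm set \<Rightarrow> ('k, 'm set) graded_alg" where
  "quotient_alg A I =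
    \<lparr> gcarrier = coset A I ` gcarrier A,
      gzero = coset A I (gzero A),
      gadd = (\<lambda>P Q. \<Union>x\<in>P. \<Union>y\<in>Q. coset A I (gadd A x y)),
      gmult = (\<lambda>P Q. \<Union>x\<in>P. \<Union>y\<in>Q. coset A I (gmult A x y)),
      gscale = (\<lambda>c P. \<Union>x\<in>P. coset A I (gscale A c x)),
      gdeg = (\<lambda>n. coset A I ` gdeg A n) \<rparr>"

text \<open>\<open>corner_alg A F\<close> is \<open>\<Sum>f,g\<in>F. f A g\<close>, for a set \<open>F\<close> of idempotents.\<close>

definition corner_alg ::
  "('k, 'm) graded_alg \<Rightarrow> 'm set \<Rightarrow> ('k, 'm) graded_alg" where
  "corner_alg A F =
    (let C = lin_span A {gmult A (gmult A f v) g | f v g. f \<in> F \<and> v \<in> gcarrier A \<and> g \<in> F}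
     in A \<lparr> gcarrier := C, gdeg := (\<lambda>n. C \<inter> gdeg A n) \<rparr>)"


section \<open>Path algebras and quadratic duals\<close>

text \<open>
  A quiver is a \<^typ>\<open>('v, 'a) pre_digraph\<close>. A path is a triple consisting of its source, its list
  of arrows in order of traversal (composition is from left to right) and its target; the triple
  \<open>(x, [], x)\<close> is the trivial path at \<open>x\<close>.
\<close>

type_synonym ('v, 'a) path = "'v \<times> 'a list \<times> 'v"

definition paths :: "('v, 'a) pre_digraph \<Rightarrow> ('v, 'a) path set" where
  "paths G = {(u, p, v). pre_digraph.awalk G u p v}"

definition path_comp ::
  "('v, 'a) path \<Rightarrow> ('v, 'a) path \<Rightarrow> (('v, 'a) path \<Rightarrow>\<^sub>0 'k::field)" where
  "path_comp s t =
     (case s of (u, p, v) \<Rightarrow> case t of (u', p', v') \<Rightarrow>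
        if v = u' then Poly_Mapping.single (u, p @ p', v') 1 else 0)"

definition path_scale :: "'k::field \<Rightarrow> ('p \<Rightarrow>\<^sub>0 'k) \<Rightarrow> ('p \<Rightarrow>\<^sub>0 'k)" where
  "path_scale c = Poly_Mapping.map ((*) c)"

definition path_mult ::
  "(('v, 'a) path \<Rightarrow>\<^sub>0 'k::field) \<Rightarrow> (('v, 'a) path \<Rightarrow>\<^sub>0 'k) \<Rightarrow> (('v, 'a) path \<Rightarrow>\<^sub>0 'k)"
  (infixl \<open>\<cdot>\<close> 70) where
  "p \<cdot> q = (\<Sum>s\<in>Poly_Mapping.keys p. \<Sum>t\<in>Poly_Mapping.keys q.
              path_scale (Poly_Mapping.lookup p s * Poly_Mapping.lookup q t) (path_comp s t))"

definition path_algebra ::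
  "('v, 'a) pre_digraph \<Rightarrow> ('k::field, ('v, 'a) path \<Rightarrow>\<^sub>0 'k) graded_alg" where
  "path_algebra G =
    \<lparr> gcarrier = {p. Poly_Mapping.keys p \<subseteq> paths G},
      gzero = 0,
      gadd = (+),
      gmult = (\<cdot>),
      gscale = path_scale,
      gdeg = (\<lambda>n. {p. Poly_Mapping.keys p \<subseteq> {(u, w, v) \<in> paths G. length w = n}}) \<rparr>"

text \<open>
  A quiver \<open>G\<close> with a homomorphism \<open>\<pi>\<close> from its path algebra to \<open>A\<close> is the quiver of \<open>A\<close> when \<open>\<pi>\<close>
  identifies the vertices of \<open>G\<close> with a basis of the degree zero part of \<open>A\<close> and the arrows with
  a basis of the degree one part.
\<close>

definition is_quiver_of ::
  "('v, 'a) pre_digraph \<Rightarrow> ((('v, 'a) path \<Rightarrow>\<^sub>0 'k::field) \<Rightarrow> 'm) \<Rightarrow> ('k, 'm) graded_alg \<Rightarrow> bool" where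
  "is_quiver_of G \<pi> A \<longleftrightarrow>
     graded_hom (path_algebra G) A \<pi> \<and>
     (\<forall>n \<le> 1. bij_betw \<pi> (gdeg (path_algebra G) n) (gdeg A n))"

definition quadratic_relations ::
  "('v, 'a) pre_digraph \<Rightarrow> ((('v, 'a) path \<Rightarrow>\<^sub>0 'k::field) \<Rightarrow> 'm) \<Rightarrow> ('k, 'm) graded_alg
     \<Rightarrow> (('v, 'a) path \<Rightarrow>\<^sub>0 'k) set" where
  "quadratic_relations G \<pi> A = {p \<in> gdeg (path_algebra G) 2. \<pi> p = gzero A}"

text \<open>
  The pairing is the one for which the paths of length two are orthonormal, i.e.\ arrows are
  identified with the dual basis of the dual space of the degree one part. Quiver and dual quiver
  have the same orientation.
\<close>

definition orthogonal_complement ::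
  "('v, 'a) pre_digraph \<Rightarrow> (('v, 'a) path \<Rightarrow>\<^sub>0 'k::field) set \<Rightarrow> (('v, 'a) path \<Rightarrow>\<^sub>0 'k) set" where
  "orthogonal_complement G R =
     {q \<in> gdeg (path_algebra G) 2.
        \<forall>p \<in> R. (\<Sum>s\<in>Poly_Mapping.keys p. Poly_Mapping.lookup p s * Poly_Mapping.lookup q s) = 0}"

definition quadratic_dual ::
  "('v, 'a) pre_digraph \<Rightarrow> ((('v, 'a) path \<Rightarrow>\<^sub>0 'k::field) \<Rightarrow> 'm) \<Rightarrow> ('k, 'm) graded_alg
     \<Rightarrow> ('k, (('v, 'a) path \<Rightarrow>\<^sub>0 'k) set) graded_alg" where
  "quadratic_dual G \<pi> A =
     quotient_alg (path_algebra G)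
       (ideal_gen (path_algebra G) (orthogonal_complement G (quadratic_relations G \<pi> A)))"


section \<open>Cubist subsets\<close>

text \<open>
  A point of \<open>\<int>\<^sup>r\<close> is a function with coordinates \<open>1, \<dots>, r\<close> that is zero elsewhere, so the
  componentwise order is the pointwise order on functions.
\<close>

definition zlattice :: "nat \<Rightarrow> (nat \<Rightarrow> int) set" where
  "zlattice r = {x. \<forall>i. i \<notin> {1..r} \<longrightarrow> x i = 0}"

definition translate :: "nat \<Rightarrow> int \<Rightarrow> (nat \<Rightarrow> int) \<Rightarrow> (nat \<Rightarrow> int)" where
  "translate r n x = (\<lambda>i. if i \<in> {1..r} then x i + n else 0)"

definition order_ideal :: "nat \<Rightarrow> (nat \<Rightarrow> int) set \<Rightarrow> bool" where
  "order_ideal r D \<longleftrightarrow> D \<subseteq> zlattice r \<and> (\<forall>x \<in> D. \<forall>y \<in> zlattice r. y \<le> x \<longrightarrow> y \<in> D)"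

definition cubist :: "nat \<Rightarrow> (nat \<Rightarrow> int) set \<Rightarrow> bool" where
  "cubist r X \<longleftrightarrow>
     (\<exists>D. order_ideal r D \<and> D \<noteq> {} \<and> D \<noteq> zlattice r \<and> X = D - translate r (-1) ` D)"


section \<open>The algebras \<open>U\<^sub>X\<close> and \<open>V\<^sub>X\<close>\<close>

text \<open>
  \<open>U\<^sub>r\<close> and \<open>V\<^sub>r\<close> are quotients of the path algebra of one quiver: \<open>Up x i\<close> stands for
  \<open>a\<^bsub>x,i\<^esub>\<close> as well as \<open>\<alpha>\<^bsub>x,i\<^esub>\<close>, and \<open>Down x i\<close> for \<open>b\<^bsub>x,i\<^esub>\<close> as well as \<open>\<beta>\<^bsub>x,i\<^esub>\<close>.
\<close>

datatype cube_arrow = Up "nat \<Rightarrow> int" nat | Down "nat \<Rightarrow> int" nat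

definition inc :: "(nat \<Rightarrow> int) \<Rightarrow> nat \<Rightarrow> (nat \<Rightarrow> int)" where
  "inc x i = x(i := x i + 1)"

definition dec :: "(nat \<Rightarrow> int) \<Rightarrow> nat \<Rightarrow> (nat \<Rightarrow> int)" where
  "dec x i = x(i := x i - 1)"

fun arrow_source :: "cube_arrow \<Rightarrow> (nat \<Rightarrow> int)" where
  "arrow_source (Up x i) = x"
| "arrow_source (Down x i) = x"

fun arrow_target :: "cube_arrow \<Rightarrow> (nat \<Rightarrow> int)" where
  "arrow_target (Up x i) = inc x i"
| "arrow_target (Down x i) = dec x i"

definition cube_quiver :: "nat \<Rightarrow> (nat \<Rightarrow> int, cube_arrow) pre_digraph" where
  "cube_quiver r =
    \<lparr> verts = zlattice r,
      arcs = {Up x i | x i. x \<in> zlattice r \<and> i \<in> {1..r}} \<union>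
             {Down x i | x i. x \<in> zlattice r \<and> i \<in> {1..r}},
      tail = arrow_source,
      head = arrow_target \<rparr>"

type_synonym 'k cube_path_sum = "(nat \<Rightarrow> int, cube_arrow) path \<Rightarrow>\<^sub>0 'k"

definition vertex :: "(nat \<Rightarrow> int) \<Rightarrow> 'k::field cube_path_sum" where
  "vertex x = Poly_Mapping.single (x, [], x) 1"

definition up :: "(nat \<Rightarrow> int) \<Rightarrow> nat \<Rightarrow> 'k::field cube_path_sum" where
  "up x i = Poly_Mapping.single (x, [Up x i], inc x i) 1"

definition down :: "(nat \<Rightarrow> int) \<Rightarrow> nat \<Rightarrow> 'k::field cube_path_sum" where
  "down x i = Poly_Mapping.single (x, [Down x i], dec x i) 1"

definition U_relations :: "nat \<Rightarrow> 'k::field cube_path_sum set" where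
  "U_relations r =
     {up x i \<cdot> up (inc x i) i | x i. x \<in> zlattice r \<and> i \<in> {1..r}} \<union>
     {down x i \<cdot> down (dec x i) i | x i. x \<in> zlattice r \<and> i \<in> {1..r}} \<union>
     {up x i \<cdot> up (inc x i) j + up x j \<cdot> up (inc x j) i
        | x i j. x \<in> zlattice r \<and> i \<in> {1..r} \<and> j \<in> {1..r} \<and> i \<noteq> j} \<union>
     {down x i \<cdot> down (dec x i) j + down x j \<cdot> down (dec x j) i
        | x i j. x \<in> zlattice r \<and> i \<in> {1..r} \<and> j \<in> {1..r} \<and> i \<noteq> j} \<union>
     {up x i \<cdot> down (inc x i) j + down x j \<cdot> up (dec x j) i
        | x i j. x \<in> zlattice r \<and> i \<in> {1..r} \<and> j \<in> {1..r} \<and> i \<noteq> j} \<union>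
     {(down x i \<cdot> up (dec x i) i + up x i \<cdot> down (inc x i) i)
        - (down x (i + 1) \<cdot> up (dec x (i + 1)) (i + 1) + up x (i + 1) \<cdot> down (inc x (i + 1)) (i + 1))
        | x i. x \<in> zlattice r \<and> 1 \<le> i \<and> i < r}"

definition V_relations :: "nat \<Rightarrow> 'k::field cube_path_sum set" where
  "V_relations r =
     {up x i \<cdot> up (inc x i) j - up x j \<cdot> up (inc x j) i
        | x i j. x \<in> zlattice r \<and> i \<in> {1..r} \<and> j \<in> {1..r} \<and> i \<noteq> j} \<union>
     {down x i \<cdot> down (dec x i) j - down x j \<cdot> down (dec x j) i
        | x i j. x \<in> zlattice r \<and> i \<in> {1..r} \<and> j \<in> {1..r} \<and> i \<noteq> j} \<union>
     {up x i \<cdot> down (inc x i) j - down x j \<cdot> up (dec x j) i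
        | x i j. x \<in> zlattice r \<and> i \<in> {1..r} \<and> j \<in> {1..r}} \<union>
     {(\<Sum>i = 1..r. down x i \<cdot> up (dec x i) i) | x. x \<in> zlattice r}"

definition U_ideal :: "nat \<Rightarrow> 'k::field cube_path_sum set" where
  "U_ideal r = ideal_gen (path_algebra (cube_quiver r)) (U_relations r)"

definition V_ideal :: "nat \<Rightarrow> 'k::field cube_path_sum set" where
  "V_ideal r = ideal_gen (path_algebra (cube_quiver r)) (V_relations r)"

definition U_alg :: "nat \<Rightarrow> ('k::field, 'k cube_path_sum set) graded_alg" where
  "U_alg r = quotient_alg (path_algebra (cube_quiver r)) (U_ideal r)"

definition V_alg :: "nat \<Rightarrow> ('k::field, 'k cube_path_sum set) graded_alg" where
  "V_alg r = quotient_alg (path_algebra (cube_quiver r)) (V_ideal r)"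

definition U_class :: "nat \<Rightarrow> 'k::field cube_path_sum \<Rightarrow> 'k cube_path_sum set" where
  "U_class r = coset (path_algebra (cube_quiver r)) (U_ideal r)"

definition V_class :: "nat \<Rightarrow> 'k::field cube_path_sum \<Rightarrow> 'k cube_path_sum set" where
  "V_class r = coset (path_algebra (cube_quiver r)) (V_ideal r)"

definition U_cubist ::
  "nat \<Rightarrow> (nat \<Rightarrow> int) set \<Rightarrow> ('k::field, 'k cube_path_sum set set) graded_alg" where
  "U_cubist r X =
     quotient_alg (U_alg r)
       (lin_span (U_alg r)
         {gmult (U_alg r) (gmult (U_alg r) u (U_class r (vertex x))) v | u x v.
            u \<in> gcarrier (U_alg r) \<and> x \<in> zlattice r - X \<and> v \<in> gcarrier (U_alg r)})"

definition V_cubist ::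
  "nat \<Rightarrow> (nat \<Rightarrow> int) set \<Rightarrow> ('k::field, 'k cube_path_sum set) graded_alg" where
  "V_cubist r X = corner_alg (V_alg r) ((\<lambda>x. V_class r (vertex x)) ` X)"

text \<open>
  The quiver of \<open>V\<^sub>X\<close> is the full subquiver on \<open>X\<close>, see \<open>is_quiver_of_V_cubist\<close> below.
\<close>

definition V_cubist_dual ::
  "nat \<Rightarrow> (nat \<Rightarrow> int) set \<Rightarrow> ('k::field, 'k cube_path_sum set) graded_alg" where
  "V_cubist_dual r X = quadratic_dual (cube_quiver r \<restriction> X) (V_class r) (V_cubist r X)"

section \<open>The quiver of \<open>V\<^sub>X\<close>\<close>

lemma cubist_subset: "cubist r X \<Longrightarrow> X \<subseteq> zlattice r"
  unfolding cubist_def order_ideal_def by blast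

lemma lookup_path_scale [simp]:
  "Poly_Mapping.lookup (path_scale c p) s = c * Poly_Mapping.lookup p s"
  by (simp add: path_scale_def map.rep_eq when_def)

lemma path_scale_simps:
  "path_scale c (p + q) = path_scale c p + path_scale c q"
  "path_scale (c + d) p = path_scale c p + path_scale d p"
  "path_scale c (path_scale d p) = path_scale (c * d) p"
  "path_scale c 0 = 0" "path_scale 0 p = 0" "path_scale 1 p = p"
  "path_scale (- 1) p = - p"
  by (rule poly_mapping_eqI; simp add: lookup_add algebra_simps)+

lemma path_scale_sum: "path_scale c (\<Sum>i\<in>A. f i) = (\<Sum>i\<in>A. path_scale c (f i))"
  by (rule poly_mapping_eqI) (simp add: lookup_sum sum_distrib_left)

lemma keys_path_scale: "Poly_Mapping.keys (path_scale c p) \<subseteq> Poly_Mapping.keys p"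
  by (auto simp: in_keys_iff)

lemma path_mult_superset:
  assumes "finite A" "finite B" "Poly_Mapping.keys p \<subseteq> A" "Poly_Mapping.keys q \<subseteq> B"
  shows "p \<cdot> q = (\<Sum>s\<in>A. \<Sum>t\<in>B.
           path_scale (Poly_Mapping.lookup p s * Poly_Mapping.lookup q t) (path_comp s t))"
proof -
  have "(\<Sum>t\<in>Poly_Mapping.keys q. path_scale (Poly_Mapping.lookup p s * Poly_Mapping.lookup q t) (path_comp s t))
      = (\<Sum>t\<in>B. path_scale (Poly_Mapping.lookup p s * Poly_Mapping.lookup q t) (path_comp s t))" for s
    by (rule sum.mono_neutral_left) (use assms in \<open>auto simp: in_keys_iff path_scale_simps\<close>)
  then show ?thesis
    unfolding path_mult_def
    by simp (rule sum.mono_neutral_left; use assms in \<open>auto simp: in_keys_iff path_scale_simps\<close>)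
qed

lemma path_mult_add_left: "(p + p') \<cdot> q = p \<cdot> q + p' \<cdot> q"
proof -
  let ?A = "Poly_Mapping.keys p \<union> Poly_Mapping.keys p'" and ?B = "Poly_Mapping.keys q"
  have "(p + p') \<cdot> q = (\<Sum>s\<in>?A. \<Sum>t\<in>?B.
      path_scale (Poly_Mapping.lookup (p + p') s * Poly_Mapping.lookup q t) (path_comp s t))"
    by (rule path_mult_superset) (use Poly_Mapping.keys_add[of p p'] in auto)
  also have "\<dots> = p \<cdot> q + p' \<cdot> q"
    by (subst (1 2) path_mult_superset[of ?A ?B])
       (auto simp: lookup_add distrib_right path_scale_simps sum.distrib)
  finally show ?thesis .
qed

lemma path_mult_add_right: "p \<cdot> (q + q') = p \<cdot> q + p \<cdot> q'"
proof -
  let ?A = "Poly_Mapping.keys p" and ?B = "Poly_Mapping.keys q \<union> Poly_Mapping.keys q'"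
  have "p \<cdot> (q + q') = (\<Sum>s\<in>?A. \<Sum>t\<in>?B.
      path_scale (Poly_Mapping.lookup p s * Poly_Mapping.lookup (q + q') t) (path_comp s t))"
    by (rule path_mult_superset) (use Poly_Mapping.keys_add[of q q'] in auto)
  also have "\<dots> = p \<cdot> q + p \<cdot> q'"
    by (subst (1 2) path_mult_superset[of ?A ?B])
       (auto simp: lookup_add distrib_left path_scale_simps sum.distrib)
  finally show ?thesis .
qed

lemma path_mult_single:
  "Poly_Mapping.single s c \<cdot> Poly_Mapping.single t d = path_scale (c * d) (path_comp s t)"
  by (subst path_mult_superset[of "{s}" "{t}"]) auto

lemma keys_path_mult:
  assumes "x \<in> Poly_Mapping.keys (p \<cdot> q)"
  obtains u w v w' v' where "(u, w, v) \<in> Poly_Mapping.keys p" "(v, w', v') \<in> Poly_Mapping.keys q"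
    "x = (u, w @ w', v')"
proof -
  from assms have "(\<Sum>s\<in>Poly_Mapping.keys p. \<Sum>t\<in>Poly_Mapping.keys q.
      Poly_Mapping.lookup p s * Poly_Mapping.lookup q t * Poly_Mapping.lookup (path_comp s t) x) \<noteq> 0"
    by (simp add: path_mult_def in_keys_iff lookup_sum)
  then obtain s where s: "s \<in> Poly_Mapping.keys p" "(\<Sum>t\<in>Poly_Mapping.keys q.
      Poly_Mapping.lookup p s * Poly_Mapping.lookup q t * Poly_Mapping.lookup (path_comp s t) x) \<noteq> 0"
    by (meson sum.neutral)
  then obtain t where t: "t \<in> Poly_Mapping.keys q"
    "Poly_Mapping.lookup p s * Poly_Mapping.lookup q t * Poly_Mapping.lookup (path_comp s t) x \<noteq> 0"
    by (meson sum.neutral)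
  obtain u w v u' w' v' where st: "s = (u, w, v)" "t = (u', w', v')"
    by (metis prod_cases3)
  from t(2) have "Poly_Mapping.lookup (path_comp s t :: _ \<Rightarrow>\<^sub>0 'c) x \<noteq> 0" by auto
  then have "v = u'" "x = (u, w @ w', v')"
    unfolding st path_comp_def by (auto simp: lookup_single when_def split: if_splits)
  with s(1) t(1) st that show thesis by auto
qed

lemma cas_append:
  "pre_digraph.cas G u p v \<Longrightarrow> pre_digraph.cas G v p' v' \<Longrightarrow> pre_digraph.cas G u (p @ p') v'"
  by (induction p arbitrary: u) (auto simp: pre_digraph.cas.simps)

lemma paths_append:
  "(u, p, v) \<in> paths G \<Longrightarrow> (v, p', v') \<in> paths G \<Longrightarrow> (u, p @ p', v') \<in> paths G"
  by (auto simp: paths_def pre_digraph.awalk_def intro: cas_append)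

lemma path_mult_carrier:
  assumes "Poly_Mapping.keys p \<subseteq> paths G" "Poly_Mapping.keys q \<subseteq> paths G"
  shows "Poly_Mapping.keys (p \<cdot> q) \<subseteq> paths G"
proof
  fix x assume "x \<in> Poly_Mapping.keys (p \<cdot> q)"
  then show "x \<in> paths G"
    by (rule keys_path_mult) (use assms in \<open>auto intro: paths_append\<close>)
qed

text \<open>Cosets of a subset of the path algebra that is closed as an ideal\<close>

definition path_ideal :: "('v, 'a) pre_digraph \<Rightarrow> (('v, 'a) path \<Rightarrow>\<^sub>0 'k::field) set \<Rightarrow> bool" where
  "path_ideal G I \<longleftrightarrow> 0 \<in> I \<and> (\<forall>x\<in>I. \<forall>y\<in>I. x + y \<in> I) \<and> (\<forall>c. \<forall>x\<in>I. path_scale c x \<in> I) \<and>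
     (\<forall>a. \<forall>x\<in>I. Poly_Mapping.keys a \<subseteq> paths G \<longrightarrow> a \<cdot> x \<in> I \<and> x \<cdot> a \<in> I) \<and>
     (\<forall>x\<in>I. Poly_Mapping.keys x \<subseteq> paths G)"

lemma path_ideal_gen:
  assumes "\<forall>x\<in>S. Poly_Mapping.keys x \<subseteq> paths G"
  shows "path_ideal G (ideal_gen (path_algebra G) S)"
proof -
  let ?A = "path_algebra G"
  have "Poly_Mapping.keys x \<subseteq> paths G" if "x \<in> ideal_gen ?A S" for x
    using that
  proof induction
    case (add x y)
    then show ?case using Poly_Mapping.keys_add[of x y] by (auto simp: path_algebra_def)
  next
    case (scale x c)
    then show ?case using keys_path_scale[of c x] by (auto simp: path_algebra_def)
  next
    case (left a x)
    then show ?case using path_mult_carrier[of a G x] by (auto simp: path_algebra_def)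
  next
    case (right a x)
    then show ?case using path_mult_carrier[of x G a] by (auto simp: path_algebra_def)
  qed (use assms in \<open>auto simp: path_algebra_def\<close>)
  then show ?thesis
    unfolding path_ideal_def
    using ideal_gen.zero[of ?A S] ideal_gen.add[of _ ?A S] ideal_gen.scale[of _ ?A S]
      ideal_gen.left[of _ ?A _ S] ideal_gen.right[of _ ?A _ S]
    by (auto simp: path_algebra_def)
qed

lemma path_ideal_uminus: "path_ideal G I \<Longrightarrow> x \<in> I \<Longrightarrow> - x \<in> I"
  unfolding path_ideal_def by (metis path_scale_simps(7))

lemma path_coset_eq_iff:
  assumes "path_ideal G I"
  shows "coset (path_algebra G) I x = coset (path_algebra G) I y \<longleftrightarrow> x - y \<in> I"
proof
  assume "coset (path_algebra G) I x = coset (path_algebra G) I y"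
  moreover have "x \<in> coset (path_algebra G) I x"
    using assms by (force simp: coset_def path_algebra_def path_ideal_def)
  ultimately have "x \<in> coset (path_algebra G) I y" by simp
  then obtain i where "i \<in> I" "x = y + i" by (auto simp: coset_def path_algebra_def)
  then show "x - y \<in> I" by simp
next
  assume *: "x - y \<in> I"
  have sub: "coset (path_algebra G) I x \<subseteq> coset (path_algebra G) I y" if "x - y \<in> I" for x y
  proof
    fix z assume "z \<in> coset (path_algebra G) I x"
    then obtain i where i: "i \<in> I" "z = x + i" by (auto simp: coset_def path_algebra_def)
    then have "(x - y) + i \<in> I" "z = y + ((x - y) + i)"
      using assms that by (auto simp: path_ideal_def)
    then show "z \<in> coset (path_algebra G) I y"
      unfolding coset_def path_algebra_def by (simp only: graded_alg.simps image_iff) blast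
  qed
  have "y - x \<in> I" using path_ideal_uminus[OF assms *] by simp
  with * sub show "coset (path_algebra G) I x = coset (path_algebra G) I y" by blast
qed

lemma path_coset_ops:
  fixes G :: "('v, 'a) pre_digraph" and I :: "(('v, 'a) path \<Rightarrow>\<^sub>0 'k::field) set"
  assumes I: "path_ideal G I"
  defines "c \<equiv> coset (path_algebra G) I" and "Q \<equiv> quotient_alg (path_algebra G) I"
  shows "gadd Q (c x) (c y) = c (x + y)"
    and "gscale Q a (c x) = c (path_scale a x)"
    and "Poly_Mapping.keys x \<subseteq> paths G \<Longrightarrow> Poly_Mapping.keys y \<subseteq> paths G \<Longrightarrow>
           gmult Q (c x) (c y) = c (x \<cdot> y)"
proof -
  have mem: "z \<in> c x \<longleftrightarrow> (\<exists>i\<in>I. z = x + i)" for z x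
    by (auto simp: c_def coset_def path_algebra_def)
  have ex: "\<exists>z. z \<in> c x" for x
    using I by (auto simp: mem path_ideal_def)
  have eq: "c u = c v" if "u - v \<in> I" for u v
    using that path_coset_eq_iff[OF I] by (simp add: c_def)
  show "gadd Q (c x) (c y) = c (x + y)"
  proof -
    have "c (x' + y') = c (x + y)" if "x' \<in> c x" "y' \<in> c y" for x' y'
    proof -
      from that obtain i j where "i \<in> I" "x' = x + i" "j \<in> I" "y' = y + j" by (auto simp: mem)
      then show ?thesis using I by (intro eq) (auto simp: path_ideal_def algebra_simps)
    qed
    with ex[of x] ex[of y] show ?thesis
      by (auto simp: Q_def quotient_alg_def c_def[symmetric]) (auto simp: path_algebra_def; blast?)+
  qed
  show "gscale Q a (c x) = c (path_scale a x)"
  proof -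
    have "c (path_scale a x') = c (path_scale a x)" if "x' \<in> c x" for x'
    proof -
      from that obtain i where "i \<in> I" "x' = x + i" by (auto simp: mem)
      then show ?thesis using I by (intro eq) (auto simp: path_ideal_def path_scale_simps)
    qed
    with ex[of x] show ?thesis
      by (auto simp: Q_def quotient_alg_def c_def[symmetric]) (auto simp: path_algebra_def; blast?)+
  qed
  assume xy: "Poly_Mapping.keys x \<subseteq> paths G" "Poly_Mapping.keys y \<subseteq> paths G"
  show "gmult Q (c x) (c y) = c (x \<cdot> y)"
  proof -
    have "c (x' \<cdot> y') = c (x \<cdot> y)" if "x' \<in> c x" "y' \<in> c y" for x' y'
    proof -
      from that obtain i j where ij: "i \<in> I" "x' = x + i" "j \<in> I" "y' = y + j" by (auto simp: mem)
      then have "x' \<cdot> y' - x \<cdot> y = x \<cdot> j + (i \<cdot> y + i \<cdot> j)"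
        by (simp add: path_mult_add_left path_mult_add_right)
      moreover have "x \<cdot> j \<in> I" "i \<cdot> y \<in> I" "i \<cdot> j \<in> I"
        using I ij xy unfolding path_ideal_def by blast+
      ultimately show ?thesis using I by (intro eq) (simp add: path_ideal_def)
    qed
    with ex[of x] ex[of y] show ?thesis
      by (auto simp: Q_def quotient_alg_def c_def[symmetric]) (auto simp: path_algebra_def; blast?)+
  qed
qed

lemma inc_mem: "x \<in> zlattice r \<Longrightarrow> i \<in> {1..r} \<Longrightarrow> inc x i \<in> zlattice r"
  and dec_mem: "x \<in> zlattice r \<Longrightarrow> i \<in> {1..r} \<Longrightarrow> dec x i \<in> zlattice r"
  by (auto simp: zlattice_def inc_def dec_def)

lemma V_relations_keys:
  assumes "p \<in> V_relations r" "s \<in> Poly_Mapping.keys p"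
  shows "s \<in> paths (cube_quiver r) \<and> length (fst (snd s)) = 2"
proof -
  let ?W = "{s \<in> paths (cube_quiver r). length (fst (snd s)) = 2}"
  have two: "Poly_Mapping.keys (Poly_Mapping.single (x, [a], y) 1 \<cdot> Poly_Mapping.single (y, [b], z) (1::'a)) \<subseteq> ?W"
    if "x \<in> zlattice r" "a \<in> arcs (cube_quiver r)" "b \<in> arcs (cube_quiver r)"
      "arrow_source a = x" "arrow_target a = y" "arrow_source b = y" "arrow_target b = z" for x y z a b
    using that by (auto simp: path_mult_single path_comp_def path_scale_simps paths_def
        pre_digraph.awalk_def pre_digraph.cas.simps cube_quiver_def split: if_splits)
  have arcs: "Up x i \<in> arcs (cube_quiver r)" "Down x i \<in> arcs (cube_quiver r)"
    if "x \<in> zlattice r" "i \<in> {1..r}" for x i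
    using that by (auto simp: cube_quiver_def)
  have w: "Poly_Mapping.keys (up x i \<cdot> up (inc x i) j :: 'a cube_path_sum) \<subseteq> ?W"
      "Poly_Mapping.keys (down x i \<cdot> down (dec x i) j :: 'a cube_path_sum) \<subseteq> ?W"
      "Poly_Mapping.keys (up x i \<cdot> down (inc x i) j :: 'a cube_path_sum) \<subseteq> ?W"
      "Poly_Mapping.keys (down x i \<cdot> up (dec x i) j :: 'a cube_path_sum) \<subseteq> ?W"
    if "x \<in> zlattice r" "i \<in> {1..r}" "j \<in> {1..r}" for x i j
    unfolding up_def down_def
    by (rule two; use that in \<open>auto intro!: arcs inc_mem dec_mem\<close>)+
  have diff: "Poly_Mapping.keys (p - q) \<subseteq> ?W"
    if "Poly_Mapping.keys p \<subseteq> ?W" "Poly_Mapping.keys q \<subseteq> ?W" for p q :: "'a cube_path_sum"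
    using that keys_diff[of p q] by blast
  have sum: "Poly_Mapping.keys (\<Sum>i = 1..r. f i) \<subseteq> ?W"
    if "\<And>i. i \<in> {1..r} \<Longrightarrow> Poly_Mapping.keys (f i) \<subseteq> ?W" for f :: "nat \<Rightarrow> 'a cube_path_sum"
    using keys_sum[of f "{1..r}"] that by blast
  have "Poly_Mapping.keys p \<subseteq> ?W"
    using assms(1) unfolding V_relations_def
    by (elim UnE CollectE exE conjE; hypsubst)
       (intro diff sum w; simp)+
  with assms(2) show ?thesis by auto
qed

lemma path_ideal_V: "path_ideal (cube_quiver r) (V_ideal r)"
  unfolding V_ideal_def using V_relations_keys by (intro path_ideal_gen) blast

lemma V_ideal_keys:
  assumes "p \<in> V_ideal r" "s \<in> Poly_Mapping.keys p"
  shows "2 \<le> length (fst (snd s))"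
  using assms unfolding V_ideal_def
proof (induction arbitrary: s)
  case (base x)
  then show ?case using V_relations_keys by fastforce
next
  case (add x y)
  from add.prems have "s \<in> Poly_Mapping.keys (x + y)" by (simp add: path_algebra_def)
  then show ?case using Poly_Mapping.keys_add[of x y] add.IH by blast
next
  case (scale x c)
  from scale.prems have "s \<in> Poly_Mapping.keys (path_scale c x)" by (simp add: path_algebra_def)
  then show ?case using keys_path_scale[of c x] scale.IH by blast
next
  case (left a x)
  from left.prems have "s \<in> Poly_Mapping.keys (a \<cdot> x)" by (simp add: path_algebra_def)
  then show ?case by (rule keys_path_mult) (use left.IH in force)
next
  case (right a x)
  from right.prems have "s \<in> Poly_Mapping.keys (x \<cdot> a)" by (simp add: path_algebra_def)
  then show ?case by (rule keys_path_mult) (use right.IH in force)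
qed (auto simp: path_algebra_def)

lemma V_class_ops:
  "gadd (V_alg r) (V_class r x) (V_class r y) = V_class r (x + y)"
  "gscale (V_alg r) a (V_class r x) = V_class r (path_scale a x)"
  "Poly_Mapping.keys x \<subseteq> paths (cube_quiver r) \<Longrightarrow> Poly_Mapping.keys y \<subseteq> paths (cube_quiver r) \<Longrightarrow>
     gmult (V_alg r) (V_class r x) (V_class r y) = V_class r (x \<cdot> y)"
  "gzero (V_alg r) = V_class r 0"
  unfolding V_alg_def V_class_def
  by (simp_all add: path_coset_ops[OF path_ideal_V]) (simp add: quotient_alg_def path_algebra_def)

lemma paths_subquiver:
  assumes "X \<subseteq> zlattice r"
  shows "paths (cube_quiver r \<restriction> X) \<subseteq> {(u, w, v) \<in> paths (cube_quiver r). u \<in> X \<and> v \<in> X}"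
proof -
  have X: "v \<in> X" if "u \<in> X" "set w \<subseteq> arcs (cube_quiver r \<restriction> X)" "pre_digraph.cas (cube_quiver r \<restriction> X) u w v" for u w v
    using that by (induction w arbitrary: u) (auto simp: pre_digraph.cas.simps)
  have cas: "pre_digraph.cas (cube_quiver r) u w v"
    if "pre_digraph.cas (cube_quiver r \<restriction> X) u w v" for u w v
    using that by (induction w arbitrary: u) (auto simp: pre_digraph.cas.simps)
  show ?thesis
  proof clarify
    fix u w v assume "(u, w, v) \<in> paths (cube_quiver r \<restriction> X)"
    then have w: "u \<in> X" "set w \<subseteq> arcs (cube_quiver r \<restriction> X)"
        "pre_digraph.cas (cube_quiver r \<restriction> X) u w v"
      by (simp_all add: paths_def pre_digraph.awalk_def)
    have "u \<in> verts (cube_quiver r)" using w(1) assms by (auto simp: cube_quiver_def)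
    moreover have "set w \<subseteq> arcs (cube_quiver r)" using w(2) by auto
    ultimately have "(u, w, v) \<in> paths (cube_quiver r)"
      using cas[OF w(3)] by (simp add: paths_def pre_digraph.awalk_def)
    with w(1) X[OF w] show "(u, w, v) \<in> paths (cube_quiver r) \<and> u \<in> X \<and> v \<in> X" by blast
  qed
qed

lemma short_paths_subquiver:
  assumes "(u, w, v) \<in> paths (cube_quiver r)" "u \<in> X" "v \<in> X" "length w \<le> 1"
  shows "(u, w, v) \<in> paths (cube_quiver r \<restriction> X)"
  using assms by (cases w) (auto simp: paths_def pre_digraph.awalk_def pre_digraph.cas.simps)

lemma keys_vertex_mult:
  fixes p :: "'k::field cube_path_sum"
  assumes "s \<in> Poly_Mapping.keys (vertex x \<cdot> p \<cdot> vertex y)"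
  shows "fst s = x \<and> snd (snd s) = y"
  using assms by (elim keys_path_mult) (auto simp: vertex_def)

lemma gcarrier_V_cubist:
  assumes X: "X \<subseteq> zlattice r"
  shows "gcarrier (V_cubist r X :: ('k::field, 'k cube_path_sum set) graded_alg)
    = V_class r ` {p. Poly_Mapping.keys p \<subseteq> {(u, w, v) \<in> paths (cube_quiver r). u \<in> X \<and> v \<in> X}}"
    (is "?C = V_class r ` ?P")
proof -
  let ?A = "V_alg r :: ('k, 'k cube_path_sum set) graded_alg"
  let ?F = "(\<lambda>x. V_class r (vertex x :: 'k cube_path_sum)) ` X"
  let ?S = "{gmult ?A (gmult ?A f v) g | f v g. f \<in> ?F \<and> v \<in> gcarrier ?A \<and> g \<in> ?F}"
  have C: "?C = lin_span ?A ?S"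
    by (simp add: V_cubist_def corner_alg_def Let_def)
  have vtx: "Poly_Mapping.keys (vertex x :: 'k cube_path_sum) \<subseteq> paths (cube_quiver r)" if "x \<in> X" for x
    using that X by (auto simp: vertex_def paths_def pre_digraph.awalk_def pre_digraph.cas.simps cube_quiver_def)
  have prod: "gmult ?A (gmult ?A (V_class r (vertex x)) (V_class r p)) (V_class r (vertex y))
      = V_class r (vertex x \<cdot> p \<cdot> vertex y)"
    if "x \<in> X" "y \<in> X" "Poly_Mapping.keys p \<subseteq> paths (cube_quiver r)" for x y p
    using that vtx by (simp add: V_class_ops path_mult_carrier)
  have carr: "gcarrier ?A = V_class r ` {p. Poly_Mapping.keys p \<subseteq> paths (cube_quiver r)}"
    by (simp add: V_alg_def quotient_alg_def V_class_def) (simp add: path_algebra_def)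
  have "z \<in> V_class r ` ?P" if "z \<in> lin_span ?A ?S" for z
    using that
  proof induction
    case zero
    then show ?case by (auto simp: V_class_ops intro!: imageI)
  next
    case (base s)
    then obtain x y p where xyp: "x \<in> X" "y \<in> X" "Poly_Mapping.keys p \<subseteq> paths (cube_quiver r)"
      and s: "s = V_class r (vertex x \<cdot> p \<cdot> vertex y)"
      using prod carr by fastforce
    have "vertex x \<cdot> p \<cdot> vertex y \<in> ?P"
    proof clarify
      fix u w v assume k: "(u, w, v) \<in> Poly_Mapping.keys (vertex x \<cdot> p \<cdot> vertex y)"
      have "Poly_Mapping.keys (vertex x \<cdot> p \<cdot> vertex y) \<subseteq> paths (cube_quiver r)"
        using xyp vtx by (intro path_mult_carrier) auto
      with k keys_vertex_mult[OF k] xyp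
      show "(u, w, v) \<in> paths (cube_quiver r) \<and> u \<in> X \<and> v \<in> X" by auto
    qed
    with s show ?case by blast
  next
    case (add x y)
    then obtain p q where "x = V_class r p" "y = V_class r q" "p \<in> ?P" "q \<in> ?P" by blast
    moreover from this have "p + q \<in> ?P" using Poly_Mapping.keys_add[of p q] by blast
    ultimately show ?case by (auto simp: V_class_ops)
  next
    case (scale x c)
    then obtain p where "x = V_class r p" "p \<in> ?P" by blast
    moreover from this have "path_scale c p \<in> ?P" using keys_path_scale[of c p] by blast
    ultimately show ?case by (auto simp: V_class_ops)
  qed
  moreover have "V_class r p \<in> lin_span ?A ?S" if "p \<in> ?P" for p
  proof -
    have summand: "V_class r (Poly_Mapping.single s c) \<in> lin_span ?A ?S"
      if "s \<in> Poly_Mapping.keys p" for s c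
    proof -
      obtain u w v where s: "s = (u, w, v)" by (metis prod_cases3)
      with that \<open>p \<in> ?P\<close> have uv: "u \<in> X" "v \<in> X" "s \<in> paths (cube_quiver r)" by auto
      have "vertex u \<cdot> Poly_Mapping.single s c \<cdot> vertex v = Poly_Mapping.single s c"
        unfolding vertex_def s
        by (simp add: path_mult_single path_comp_def path_scale_def)
      moreover have "gmult ?A (gmult ?A (V_class r (vertex u)) (V_class r (Poly_Mapping.single s c)))
          (V_class r (vertex v)) \<in> ?S"
      proof -
        have "V_class r (Poly_Mapping.single s c) \<in> gcarrier ?A"
          unfolding carr using uv by (intro imageI) auto
        with uv show ?thesis by blast
      qed
      ultimately show ?thesis
        using prod[of u v "Poly_Mapping.single s c"] uv lin_span.base[of _ ?S ?A] by auto
    qed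
    have sums: "V_class r (\<Sum>s\<in>K. Poly_Mapping.single s (Poly_Mapping.lookup p s)) \<in> lin_span ?A ?S"
      if "finite K" "K \<subseteq> Poly_Mapping.keys p" for K
      using that
    proof (induction K)
      case empty
      then show ?case using lin_span.zero[of ?A ?S] by (simp add: V_class_ops)
    next
      case (insert s K)
      then show ?case
        using lin_span.add[of _ ?A ?S, OF summand[of s]] by (simp add: V_class_ops(1)[symmetric])
    qed
    have "(\<Sum>s\<in>Poly_Mapping.keys p. Poly_Mapping.single s (Poly_Mapping.lookup p s)) = p"
      by (rule poly_mapping_eqI) (auto simp: lookup_sum lookup_single when_def in_keys_iff)
    then show ?thesis using sums[OF finite_keys subset_refl] by simp
  qed
  ultimately show ?thesis unfolding C by blast
qed

lemma is_quiver_of_V_cubist: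
  assumes X: "X \<subseteq> zlattice r"
  shows "is_quiver_of (cube_quiver r \<restriction> X) (V_class r)
           (V_cubist r X :: ('k::field, 'k cube_path_sum set) graded_alg)"
proof -
  let ?G = "cube_quiver r \<restriction> X"
  let ?kG = "path_algebra ?G :: ('k, 'k cube_path_sum) graded_alg"
  let ?V = "V_cubist r X :: ('k, 'k cube_path_sum set) graded_alg"
  let ?P = "{p :: 'k cube_path_sum.
    Poly_Mapping.keys p \<subseteq> {(u, w, v) \<in> paths (cube_quiver r). u \<in> X \<and> v \<in> X}}"
  note sub = paths_subquiver[OF X]
  have ops: "gzero ?V = gzero (V_alg r)" "gadd ?V = gadd (V_alg r)" "gmult ?V = gmult (V_alg r)"
      "gscale ?V = gscale (V_alg r)"
    by (simp_all add: V_cubist_def corner_alg_def Let_def)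
  have deg: "gdeg ?V n = gcarrier ?V \<inter> V_class r `
      {p. Poly_Mapping.keys p \<subseteq> {(u, w, v) \<in> paths (cube_quiver r). length w = n}}" for n
    by (simp add: V_cubist_def corner_alg_def Let_def V_alg_def quotient_alg_def V_class_def)
       (simp add: path_algebra_def)
  have degG: "gdeg ?kG n = {p. Poly_Mapping.keys p \<subseteq> {(u, w, v) \<in> paths ?G. length w = n}}" for n
    by (simp add: path_algebra_def)
  have carrG: "gcarrier ?kG = {p. Poly_Mapping.keys p \<subseteq> paths ?G}"
    by (simp add: path_algebra_def)
  have le: "V_class r ` gdeg ?kG n \<subseteq> gdeg ?V n" for n
    unfolding deg degG gcarrier_V_cubist[OF X] using sub by blast
  have hom: "graded_hom ?kG ?V (V_class r)"
    unfolding graded_hom_def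
  proof (intro conjI ballI allI le)
    show "V_class r ` gcarrier ?kG \<subseteq> gcarrier ?V"
      unfolding carrG gcarrier_V_cubist[OF X] using sub by blast
    fix x y assume "x \<in> gcarrier ?kG" "y \<in> gcarrier ?kG"
    then have "Poly_Mapping.keys x \<subseteq> paths (cube_quiver r)" "Poly_Mapping.keys y \<subseteq> paths (cube_quiver r)"
      unfolding carrG using sub by blast+
    then show "V_class r (gmult ?kG x y) = gmult ?V (V_class r x) (V_class r y)"
      by (simp add: ops V_class_ops) (simp add: path_algebra_def)
  qed (simp_all add: ops V_class_ops, simp_all add: path_algebra_def)
  have class_eq: "p = q"
    if "V_class r p = V_class r q"
      "\<And>s. s \<in> Poly_Mapping.keys (p - q) \<Longrightarrow> length (fst (snd s)) \<le> 1" for p q :: "'k cube_path_sum"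
  proof -
    have "p - q \<in> V_ideal r"
      using that(1) unfolding V_class_def path_coset_eq_iff[OF path_ideal_V] .
    then have "Poly_Mapping.keys (p - q) = {}"
      using V_ideal_keys that(2) by fastforce
    then show ?thesis by simp
  qed
  have "bij_betw (V_class r) (gdeg ?kG n) (gdeg ?V n)" if n: "n \<le> 1" for n
    unfolding bij_betw_def
  proof (intro conjI antisym le)
    show "inj_on (V_class r) (gdeg ?kG n)"
    proof (rule inj_onI)
      fix p q assume pq: "p \<in> gdeg ?kG n" "q \<in> gdeg ?kG n" "V_class r p = V_class r q"
      show "p = q"
      proof (rule class_eq[OF pq(3)])
        fix s assume "s \<in> Poly_Mapping.keys (p - q)"
        then show "length (fst (snd s)) \<le> 1"
          using pq n keys_diff[of p q] unfolding degG by (cases s) (auto; blast)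
      qed
    qed
    show "gdeg ?V n \<subseteq> V_class r ` gdeg ?kG n"
    proof
      fix z assume "z \<in> gdeg ?V n"
      then obtain p q where p: "z = V_class r p"
          "Poly_Mapping.keys p \<subseteq> {(u, w, v) \<in> paths (cube_quiver r). length w = n}"
        and q: "z = V_class r q" "q \<in> ?P"
        unfolding deg gcarrier_V_cubist[OF X] by blast
      have I: "p - q \<in> V_ideal r"
        using p(1) q(1) path_coset_eq_iff[OF path_ideal_V, of r p q] unfolding V_class_def by blast
      have "p \<in> gdeg ?kG n"
        unfolding degG
      proof clarify
        fix u w v assume k: "(u, w, v) \<in> Poly_Mapping.keys p"
        with p have w: "length w = n" "(u, w, v) \<in> paths (cube_quiver r)" by auto
        then have "(u, w, v) \<notin> Poly_Mapping.keys (p - q)"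
          using V_ideal_keys[OF I] n by fastforce
        with k have "(u, w, v) \<in> Poly_Mapping.keys q"
          by (auto simp: in_keys_iff lookup_minus)
        with q have "u \<in> X" "v \<in> X" by auto
        with w n show "(u, w, v) \<in> paths ?G \<and> length w = n"
          using short_paths_subquiver by auto
      qed
      with p show "z \<in> V_class r ` gdeg ?kG n" by blast
    qed
  qed
  with hom show ?thesis by (simp add: is_quiver_of_def)
qed

end

theory Submission
  imports Defs
begin

text \<open>
  Killing the idempotents outside \<open>X\<close> deletes the vertices outside \<open>X\<close> from the quiver, so \<open>U\<^sub>X\<close> is
  presented by the full subquiver on \<open>X\<close> and the relations of \<open>U\<^sub>r\<close> with all paths leaving \<open>X\<close>
  dropped. Dropping paths is orthogonal projection onto a coordinate subspace \<open>A\<close>, and in degree two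
  the relations \<open>W\<close> of \<open>V\<^sub>r\<close> and those of \<open>U\<^sub>r\<close> are orthogonal complements. As the relations of \<open>V\<^sub>X\<close>
  are \<open>W \<inter> A\<close>, the claim is that the complement of \<open>W \<inter> A\<close> in \<open>A\<close> is the projection of \<open>W\<^sup>\<bottom>\<close>.
  This is verified for each pair of end points, where the spaces are explicit.
\<close>

section \<open>Quotients of path algebras\<close>

text \<open>For fixed end points the claim is the duality \<open>(W \<inter> A)\<^sup>\<bottom> =
  W\<^sup>\<bottom> + A\<^sup>\<bottom>\<close>, but no dimensions are counted: one inclusion is
  orthogonality of the defining relations, the other writes each vector orthogonal to
  \<open>W \<inter> A\<close> as an element of \<open>U_ideal r\<close> plus paths leaving
  \<open>X\<close>. Three kinds of blocks occur. A path with two equal steps is orthogonal to all of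
  \<open>W\<close>. Two paths \<open>d e\<close> and \<open>e d\<close> in distinct coordinates have
  their difference in \<open>W\<close> and their sum in the complement. At a vertex there are
  \<open>2 r\<close> paths \<open>N i\<close>, \<open>P i\<close>, stepping out and back in
  coordinate \<open>i\<close>; here \<open>W\<close> is spanned by the \<open>P i - N i\<close> and
  the sum of all \<open>N i\<close>, the complement by differences of the \<open>N i + P i\<close>.
  The last block is the delicate one: the sum of the \<open>N i\<close> may leave \<open>X\<close>
  while a mixture of \<open>N i\<close> and \<open>P i\<close> stays inside. The relations of the
  corner algebra are given only as degree-two members of an ideal, so orthogonality is needed for
  the whole ideal \<open>V_ideal r\<close>. Conversely, ideals of the two path algebras are compared
  directly, so no generating set for the relations inside \<open>X\<close> is ever
  determined.\<close>

lemma path_algebra_simps [simp]: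
  "gcarrier (path_algebra G) = {p. Poly_Mapping.keys p \<subseteq> paths G}"
  "gzero (path_algebra G) = 0"
  "gadd (path_algebra G) = (+)"
  "gmult (path_algebra G) = (\<cdot>)"
  "gscale (path_algebra G) = path_scale"
  "gdeg (path_algebra G) n = {p. Poly_Mapping.keys p \<subseteq> {(u, w, v) \<in> paths G. length w = n}}"
  by (simp_all add: path_algebra_def)

lemma quotient_alg_simps:
  "gcarrier (quotient_alg A I) = coset A I ` gcarrier A"
  "gzero (quotient_alg A I) = coset A I (gzero A)"
  "gdeg (quotient_alg A I) n = coset A I ` gdeg A n"
  by (simp_all add: quotient_alg_def)

lemma path_ideal_diff: "path_ideal G I \<Longrightarrow> x \<in> I \<Longrightarrow> y \<in> I \<Longrightarrow> x - y \<in> I"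
  using path_ideal_uminus[of G I y] unfolding path_ideal_def
  by (metis add_uminus_conv_diff)

lemma path_ideal_sum: "path_ideal G I \<Longrightarrow> (\<And>i. i \<in> A \<Longrightarrow> f i \<in> I) \<Longrightarrow> (\<Sum>i\<in>A. f i) \<in> I"
  by (induction A rule: infinite_finite_induct) (auto simp: path_ideal_def)

lemma path_ideal_plus:
  fixes I J :: "(('v, 'a) path \<Rightarrow>\<^sub>0 'k::field) set"
  assumes I: "path_ideal G I" and J: "path_ideal G J"
  shows "path_ideal G {x + y | x y. x \<in> I \<and> y \<in> J}" (is "path_ideal G ?S")
proof -
  have mem: "p \<in> ?S" if "p = x + y" "x \<in> I" "y \<in> J" for p x y
    using that by blast
  show ?thesis
    unfolding path_ideal_def
  proof (intro conjI ballI allI impI)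
    show "0 \<in> ?S" by (rule mem[of _ 0 0]) (use I J in \<open>auto simp: path_ideal_def\<close>)
  next
    fix p q assume "p \<in> ?S" "q \<in> ?S"
    then obtain x y x' y' where "p = x + y" "q = x' + y'" "x \<in> I" "x' \<in> I" "y \<in> J" "y' \<in> J"
      by blast
    then show "p + q \<in> ?S"
      by (intro mem[of _ "x + x'" "y + y'"]) (use I J in \<open>auto simp: path_ideal_def algebra_simps\<close>)
  next
    fix c p assume "p \<in> ?S"
    then obtain x y where "p = x + y" "x \<in> I" "y \<in> J" by blast
    then show "path_scale c p \<in> ?S"
      by (intro mem[of _ "path_scale c x" "path_scale c y"])
        (use I J in \<open>auto simp: path_ideal_def path_scale_simps\<close>)
  next
    fix a p :: "('v, 'a) path \<Rightarrow>\<^sub>0 'k"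
    assume "p \<in> ?S" and a: "Poly_Mapping.keys a \<subseteq> paths G"
    then obtain x y where p: "p = x + y" "x \<in> I" "y \<in> J" by blast
    show "a \<cdot> p \<in> ?S"
      by (rule mem[of _ "a \<cdot> x" "a \<cdot> y"])
        (use I J p a in \<open>auto simp: path_ideal_def path_mult_add_right\<close>)
    show "p \<cdot> a \<in> ?S"
      by (rule mem[of _ "x \<cdot> a" "y \<cdot> a"])
        (use I J p a in \<open>auto simp: path_ideal_def path_mult_add_left\<close>)
  next
    fix p assume "p \<in> ?S"
    then obtain x y where "p = x + y" "x \<in> I" "y \<in> J" by blast
    moreover from this have "Poly_Mapping.keys x \<subseteq> paths G" "Poly_Mapping.keys y \<subseteq> paths G"
      using I J by (auto simp: path_ideal_def)
    ultimately show "Poly_Mapping.keys p \<subseteq> paths G"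
      using Poly_Mapping.keys_add[of x y] by blast
  qed
qed

text \<open>A first isomorphism theorem. The kernel is expressed through
  \<open>\<phi> x = \<phi> y\<close> because the target is a bare record without subtraction;
  surjectivity is asked for in each degree because \<open>graded_isomorphic\<close> demands equality
  of the graded pieces.\<close>

lemma quotient_path_algebra_isomorphic:
  fixes I :: "(('v, 'a) path \<Rightarrow>\<^sub>0 'k::field) set"
  assumes I: "path_ideal G I"
    and hom: "graded_hom (path_algebra G) B \<phi>"
    and ker: "\<And>x y. Poly_Mapping.keys x \<subseteq> paths G \<Longrightarrow> Poly_Mapping.keys y \<subseteq> paths G \<Longrightarrow>
                \<phi> x = \<phi> y \<longleftrightarrow> x - y \<in> I"
    and surj: "\<phi> ` gcarrier (path_algebra G) = gcarrier B"
    and deg: "\<And>n. \<phi> ` gdeg (path_algebra G) n = gdeg B n"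
  shows "graded_isomorphic (quotient_alg (path_algebra G) I) B"
proof -
  let ?A = "path_algebra G :: ('k, ('v, 'a) path \<Rightarrow>\<^sub>0 'k) graded_alg"
  let ?c = "coset ?A I"
  let ?S = "gcarrier ?A"
  \<comment> \<open>The representative is chosen inside the carrier, the only place where
    \<open>ker\<close> compares values of \<open>\<phi>\<close>.\<close>
  define h where "h P = \<phi> (SOME x. x \<in> ?S \<and> ?c x = P)" for P
  have h: "h (?c x) = \<phi> x" if x: "x \<in> ?S" for x
  proof -
    let ?y = "SOME y. y \<in> ?S \<and> ?c y = ?c x"
    have "?y \<in> ?S \<and> ?c ?y = ?c x" by (rule someI[of _ x]) (use x in auto)
    then have "?y \<in> ?S" "?y - x \<in> I" using path_coset_eq_iff[OF I] by blast+
    then show ?thesis unfolding h_def using ker[of ?y x] x by simp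
  qed
  note ops = path_coset_ops[OF I]
  have sub: "gdeg ?A n \<subseteq> ?S" for n by auto
  have img: "h ` ?c ` T = \<phi> ` T" if "T \<subseteq> ?S" for T
    using that h by (force simp: image_image)
  have "graded_hom (quotient_alg ?A I) B h"
    unfolding graded_hom_def quotient_alg_simps
  proof (intro conjI ballI allI)
    show "h ` ?c ` ?S \<subseteq> gcarrier B" using img[of ?S] surj by simp
    show "h (?c (gzero ?A)) = gzero B" using h[of 0] hom by (simp add: graded_hom_def)
    show "h ` ?c ` gdeg ?A n \<subseteq> gdeg B n" for n using img[OF sub] deg by simp
  next
    fix P Q assume "P \<in> ?c ` ?S" "Q \<in> ?c ` ?S"
    then obtain x y where xy: "P = ?c x" "Q = ?c y" "x \<in> ?S" "y \<in> ?S" by blast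
    then have "x + y \<in> ?S" "x \<cdot> y \<in> ?S"
      using Poly_Mapping.keys_add[of x y] path_mult_carrier[of x G y] by auto
    with xy show "h (gadd (quotient_alg ?A I) P Q) = gadd B (h P) (h Q)"
        "h (gmult (quotient_alg ?A I) P Q) = gmult B (h P) (h Q)"
      using hom by (simp_all add: ops h graded_hom_def del: path_algebra_simps(1))
        (simp_all add: ops h graded_hom_def)
  next
    fix a P assume "P \<in> ?c ` ?S"
    then obtain x where x: "P = ?c x" "x \<in> ?S" by blast
    then have "path_scale a x \<in> ?S" using keys_path_scale[of a x] by auto
    with x show "h (gscale (quotient_alg ?A I) a P) = gscale B a (h P)"
      using hom by (simp add: ops h graded_hom_def del: path_algebra_simps(1))
  qed
  moreover have "bij_betw h (gcarrier (quotient_alg ?A I)) (gcarrier B)"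
    unfolding bij_betw_def quotient_alg_simps
  proof
    show "inj_on h (?c ` ?S)"
    proof (rule inj_onI)
      fix P Q assume "P \<in> ?c ` ?S" "Q \<in> ?c ` ?S" and e: "h P = h Q"
      then obtain x y where xy: "P = ?c x" "Q = ?c y" "x \<in> ?S" "y \<in> ?S" by blast
      with e have "\<phi> x = \<phi> y" by (simp add: h)
      with xy ker have "x - y \<in> I" by simp
      then show "P = Q" using xy path_coset_eq_iff[OF I] by simp
    qed
    show "h ` ?c ` ?S = gcarrier B" using img[of ?S] surj by simp
  qed
  moreover have "h ` gdeg (quotient_alg ?A I) n = gdeg B n" for n
    unfolding quotient_alg_simps using img[OF sub] deg by simp
  ultimately show ?thesis unfolding graded_isomorphic_def by blast
qed

section \<open>Quotients of quotients: cosets of cosets\<close>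

lemma double_coset:
  assumes I: "path_ideal G I"
  shows "coset (quotient_alg (path_algebra G) I) (coset (path_algebra G) I ` Z)
             (coset (path_algebra G) I x)
         = coset (path_algebra G) I ` {x + z | z. z \<in> Z}"
proof -
  have "{x + z | z. z \<in> Z} = (+) x ` Z" by blast
  then show ?thesis
    unfolding coset_def[of "quotient_alg (path_algebra G) I"]
    by (simp only: image_image path_coset_ops(1)[OF I])
qed

text \<open>The second quotient is by the image of \<open>Z\<close>, which need not contain
  \<open>I\<close>. Passing to both quotients therefore amounts to working modulo the sum of the two
  ideals.\<close>

lemma double_coset_eq_iff:
  assumes I: "path_ideal G I" and Z: "path_ideal G Z"
  defines "c \<equiv> coset (path_algebra G) I" and "A \<equiv> quotient_alg (path_algebra G) I"
  shows "coset A (c ` Z) (c x) = coset A (c ` Z) (c y) \<longleftrightarrow> x - y \<in> {i + z | i z. i \<in> I \<and> z \<in> Z}"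
proof -
  have C: "coset A (c ` Z) (c x) = c ` {x + z | z. z \<in> Z}" for x
    unfolding c_def A_def by (rule double_coset[OF I])
  have sub: "c ` {x + z | z. z \<in> Z} \<subseteq> c ` {y + z | z. z \<in> Z}"
    if "x - y = i + z" "i \<in> I" "z \<in> Z" for x y i z
  proof clarify
    fix z' assume z': "z' \<in> Z"
    have "(x + z') - (y + (z + z')) = i" using that by (simp add: algebra_simps)
    then have "c (x + z') = c (y + (z + z'))"
      unfolding c_def path_coset_eq_iff[OF I] using that by simp
    moreover have "z + z' \<in> Z" using Z that z' by (simp add: path_ideal_def)
    ultimately show "c (x + z') \<in> c ` {y + z | z. z \<in> Z}" by blast
  qed
  show ?thesis
  proof
    assume e: "coset A (c ` Z) (c x) = coset A (c ` Z) (c y)"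
    have "c (x + 0) \<in> coset A (c ` Z) (c x)" unfolding C by (rule imageI) (use Z in \<open>auto simp: path_ideal_def\<close>)
    then have "c x \<in> c ` {y + z | z. z \<in> Z}" using e by (simp add: C)
    then obtain z where z: "z \<in> Z" "c x = c (y + z)" by blast
    then have "x - y - z \<in> I" unfolding c_def path_coset_eq_iff[OF I] by (simp add: algebra_simps)
    moreover have "x - y = (x - y - z) + z" by simp
    ultimately show "x - y \<in> {i + z | i z. i \<in> I \<and> z \<in> Z}" using z(1) by blast
  next
    assume "x - y \<in> {i + z | i z. i \<in> I \<and> z \<in> Z}"
    then obtain i z where iz: "x - y = i + z" "i \<in> I" "z \<in> Z" by blast
    have "y - x = - (x - y)" by simp
    also have "\<dots> = - i + - z" unfolding iz by simp
    finally have "y - x = - i + - z" .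
    then show "coset A (c ` Z) (c x) = coset A (c ` Z) (c y)"
      unfolding C using sub[OF iz] sub[of y x "- i" "- z"] path_ideal_uminus[OF I iz(2)] path_ideal_uminus[OF Z iz(3)]
      by (intro equalityI)
  qed
qed

text \<open>Operations on cosets are unions over representatives. Each representative of
  \<open>C x\<close> is \<open>c (x + z)\<close> with \<open>z\<close> in \<open>Z\<close>, so all
  members of the union are one and the same coset, and the union collapses because
  \<open>C x\<close> is nonempty.\<close>

lemma double_coset_ops:
  fixes I Z :: "(('v, 'a) path \<Rightarrow>\<^sub>0 'k::field) set"
  assumes I: "path_ideal G I" and Z: "path_ideal G Z"
  defines "c \<equiv> coset (path_algebra G) I" and "A \<equiv> quotient_alg (path_algebra G) I"
  defines "C \<equiv> \<lambda>x. coset A (c ` Z) (c x)" and "Q \<equiv> quotient_alg A (c ` Z)"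
  shows "gadd Q (C x) (C y) = C (x + y)"
    and "gscale Q a (C x) = C (path_scale a x)"
    and "Poly_Mapping.keys x \<subseteq> paths G \<Longrightarrow> Poly_Mapping.keys y \<subseteq> paths G \<Longrightarrow>
           gmult Q (C x) (C y) = C (x \<cdot> y)"
proof -
  note ops = path_coset_ops[OF I, folded A_def c_def]
  have mem: "P \<in> C x \<longleftrightarrow> (\<exists>z\<in>Z. P = c (x + z))" for P x
    using double_coset[OF I, of Z x] by (auto simp: C_def c_def A_def)
  have Z0: "0 \<in> Z" using Z by (simp add: path_ideal_def)
  have I0: "0 \<in> I" using I by (simp add: path_ideal_def)
  have ex: "\<exists>P. P \<in> C x" for x using mem Z0 by blast
  have eq: "C u = C v" if "u - v \<in> Z" for u v
  proof -
    have "u - v = 0 + (u - v)" by simp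
    with that I0 have "u - v \<in> {i + z | i z. i \<in> I \<and> z \<in> Z}" by blast
    then show ?thesis using double_coset_eq_iff[OF I Z] by (simp add: C_def c_def A_def)
  qed
  have C: "coset A (c ` Z) (c x) = C x" for x by (simp add: C_def)
  show "gadd Q (C x) (C y) = C (x + y)"
  proof -
    have "coset A (c ` Z) (gadd A P R) = C (x + y)" if "P \<in> C x" "R \<in> C y" for P R
    proof -
      from that obtain i j where "i \<in> Z" "P = c (x + i)" "j \<in> Z" "R = c (y + j)" by (auto simp: mem)
      then show ?thesis using Z unfolding ops
        by (simp only: ops C) (intro eq, auto simp: path_ideal_def algebra_simps)
    qed
    with ex[of x] ex[of y] show ?thesis by (auto simp: Q_def quotient_alg_def[of A])
  qed
  show "gscale Q a (C x) = C (path_scale a x)"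
  proof -
    have "coset A (c ` Z) (gscale A a P) = C (path_scale a x)" if "P \<in> C x" for P
    proof -
      from that obtain i where "i \<in> Z" "P = c (x + i)" by (auto simp: mem)
      then show ?thesis using Z
        by (simp only: ops C) (intro eq, auto simp: path_ideal_def path_scale_simps)
    qed
    with ex[of x] show ?thesis by (auto simp: Q_def quotient_alg_def[of A])
  qed
  assume xy: "Poly_Mapping.keys x \<subseteq> paths G" "Poly_Mapping.keys y \<subseteq> paths G"
  show "gmult Q (C x) (C y) = C (x \<cdot> y)"
  proof -
    have "coset A (c ` Z) (gmult A P R) = C (x \<cdot> y)" if "P \<in> C x" "R \<in> C y" for P R
    proof -
      from that obtain i j where ij: "i \<in> Z" "P = c (x + i)" "j \<in> Z" "R = c (y + j)" by (auto simp: mem)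
      have k: "Poly_Mapping.keys (x + i) \<subseteq> paths G" "Poly_Mapping.keys (y + j) \<subseteq> paths G"
        using xy ij Z Poly_Mapping.keys_add[of x i] Poly_Mapping.keys_add[of y j]
        unfolding path_ideal_def by blast+
      have "(x + i) \<cdot> (y + j) - x \<cdot> y = x \<cdot> j + (i \<cdot> y + i \<cdot> j)"
        by (simp add: path_mult_add_left path_mult_add_right)
      moreover have "x \<cdot> j \<in> Z" "i \<cdot> y \<in> Z" "i \<cdot> j \<in> Z"
        using Z ij xy unfolding path_ideal_def by blast+
      ultimately have "C ((x + i) \<cdot> (y + j)) = C (x \<cdot> y)"
        using Z by (intro eq) (simp add: path_ideal_def)
      then show ?thesis using ij k by (simp add: ops C)
    qed
    with ex[of x] ex[of y] show ?thesis by (auto simp: Q_def quotient_alg_def[of A])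
  qed
qed

section \<open>Deleting vertices\<close>

lemma (in wf_digraph) paths_simps:
  "(u, [], v) \<in> paths G \<longleftrightarrow> u = v \<and> u \<in> verts G"
  "(u, a # w, v) \<in> paths G \<longleftrightarrow> a \<in> arcs G \<and> u = tail G a \<and> (head G a, w, v) \<in> paths G"
  by (auto simp: paths_def awalk_Nil_iff awalk_Cons_iff)

lemma (in wf_digraph) paths_verts: "(u, w, v) \<in> paths G \<Longrightarrow> u \<in> verts G \<and> v \<in> verts G"
  by (induction w arbitrary: u) (auto simp: paths_simps)

text \<open>A path lies in the full subquiver exactly when every vertex it visits is in
  \<open>X\<close>, and a concatenation visits the vertices of its two pieces. Hence leaving paths
  absorb composition on either side.\<close>

lemma (in wf_digraph) paths_restrict_append_iff:
  assumes "(u, w, v) \<in> paths G" "(v, w', v') \<in> paths G"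
  shows "(u, w @ w', v') \<in> paths (G \<restriction> X) \<longleftrightarrow>
         (u, w, v) \<in> paths (G \<restriction> X) \<and> (v, w', v') \<in> paths (G \<restriction> X)"
proof -
  interpret X: wf_digraph "G \<restriction> X" by (rule wellformed_induce_subgraph)
  show ?thesis
    using assms by (induction w arbitrary: u) (auto simp: paths_simps X.paths_simps dest: X.paths_verts)
qed

lemma (in wf_digraph) paths_restrict_subset:
  assumes "X \<subseteq> verts G"
  shows "paths (G \<restriction> X) \<subseteq> paths G"
proof -
  interpret X: wf_digraph "G \<restriction> X" by (rule wellformed_induce_subgraph)
  have "(u, w, v) \<in> paths (G \<restriction> X) \<Longrightarrow> (u, w, v) \<in> paths G" for u w v
    using assms by (induction w arbitrary: u) (auto simp: paths_simps X.paths_simps)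
  then show ?thesis by auto
qed

text \<open>Cutting a leaving path at a vertex \<open>x\<close> outside \<open>X\<close> exhibits it
  as a product with the trivial path at \<open>x\<close> in the middle, which is the shape of the
  generators of the ideal killed in \<open>U_cubist\<close>.\<close>

lemma (in wf_digraph) paths_split_outside:
  assumes "(u, w, v) \<in> paths G" "(u, w, v) \<notin> paths (G \<restriction> X)"
  shows "\<exists>x w1 w2. x \<in> verts G - X \<and> w = w1 @ w2 \<and> (u, w1, x) \<in> paths G \<and> (x, w2, v) \<in> paths G"
proof -
  interpret X: wf_digraph "G \<restriction> X" by (rule wellformed_induce_subgraph)
  show ?thesis
    using assms
  proof (induction w arbitrary: u)
    case Nil
    then show ?case by (auto simp: paths_simps X.paths_simps)
  next
    case (Cons a w)
    show ?case
    proof (cases "u \<in> X")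
      case False
      with Cons.prems show ?thesis
        by (intro exI[of _ u] exI[of _ "[]"] exI[of _ "a # w"]) (auto simp: paths_simps)
    next
      case True
      with Cons.prems have a: "a \<in> arcs G" "u = tail G a" "(head G a, w, v) \<in> paths G"
        by (auto simp: paths_simps)
      moreover have "(head G a, w, v) \<notin> paths (G \<restriction> X)"
        using Cons.prems True a X.paths_verts[of "head G a" w v] by (auto simp: X.paths_simps)
      ultimately obtain x w1 w2 where "x \<in> verts G - X" "w = w1 @ w2"
          "(head G a, w1, x) \<in> paths G" "(x, w2, v) \<in> paths G"
        using Cons.IH[of "head G a"] by blast
      with a show ?thesis
        by (intro exI[of _ x] exI[of _ "a # w1"] exI[of _ w2]) (auto simp: paths_simps)
    qed
  qed
qed

text \<open>This is the ideal of the path algebra generated by the vertices of \<open>G\<close>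
  outside \<open>X\<close>, described by its basis of paths so that membership becomes a condition
  on supports.\<close>

definition leaving_sums ::
  "('v, 'a) pre_digraph \<Rightarrow> 'v set \<Rightarrow> (('v, 'a) path \<Rightarrow>\<^sub>0 'k::field) set" where
  "leaving_sums G X = {p. Poly_Mapping.keys p \<subseteq> paths G - paths (G \<restriction> X)}"

lemma (in wf_digraph) path_ideal_leaving_sums: "path_ideal G (leaving_sums G X)"
  unfolding path_ideal_def
proof (intro conjI ballI allI impI)
  fix a x :: "('a, 'b) path \<Rightarrow>\<^sub>0 'c"
  assume x: "x \<in> leaving_sums G X" and a: "Poly_Mapping.keys a \<subseteq> paths G"
  have "s \<in> paths G - paths (G \<restriction> X)" if "s \<in> Poly_Mapping.keys (a \<cdot> x)" for s
    using that
  proof (rule keys_path_mult)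
    fix u w v w' v' assume *: "(u, w, v) \<in> Poly_Mapping.keys a" "(v, w', v') \<in> Poly_Mapping.keys x"
      "s = (u, w @ w', v')"
    then have k: "(u, w, v) \<in> paths G" "(v, w', v') \<in> paths G" and "(v, w', v') \<notin> paths (G \<restriction> X)"
      using a x by (auto simp: leaving_sums_def)
    then show ?thesis
      unfolding *(3) using paths_append[OF k] paths_restrict_append_iff[OF k] by simp
  qed
  then show "a \<cdot> x \<in> leaving_sums G X" unfolding leaving_sums_def by blast
  have "s \<in> paths G - paths (G \<restriction> X)" if "s \<in> Poly_Mapping.keys (x \<cdot> a)" for s
    using that
  proof (rule keys_path_mult)
    fix u w v w' v' assume *: "(u, w, v) \<in> Poly_Mapping.keys x" "(v, w', v') \<in> Poly_Mapping.keys a"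
      "s = (u, w @ w', v')"
    then have k: "(u, w, v) \<in> paths G" "(v, w', v') \<in> paths G" and "(u, w, v) \<notin> paths (G \<restriction> X)"
      using a x by (auto simp: leaving_sums_def)
    then show ?thesis
      unfolding *(3) using paths_append[OF k] paths_restrict_append_iff[OF k] by simp
  qed
  then show "x \<cdot> a \<in> leaving_sums G X" unfolding leaving_sums_def by blast
next
  fix x y :: "('a, 'b) path \<Rightarrow>\<^sub>0 'c"
  assume "x \<in> leaving_sums G X" "y \<in> leaving_sums G X"
  then show "x + y \<in> leaving_sums G X"
    using Poly_Mapping.keys_add[of x y] unfolding leaving_sums_def by blast
next
  fix c and x :: "('a, 'b) path \<Rightarrow>\<^sub>0 'c"
  assume "x \<in> leaving_sums G X"
  then show "path_scale c x \<in> leaving_sums G X"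
    using keys_path_scale[of c x] unfolding leaving_sums_def by blast
qed (auto simp: leaving_sums_def)

lemma poly_mapping_sum_singles:
  "(\<Sum>s\<in>Poly_Mapping.keys p. Poly_Mapping.single s (Poly_Mapping.lookup p s)) = p"
  by (rule poly_mapping_eqI) (auto simp: lookup_sum lookup_single when_def in_keys_iff)

text \<open>The span of the products \<open>u e_x v\<close> is already an ideal, namely the image of
  \<open>leaving_sums\<close>. This turns the definition of \<open>U_cubist\<close> into an iterated
  quotient of a path algebra. One inclusion holds since \<open>leaving_sums\<close> absorbs
  products, the other since each leaving path can be cut outside \<open>X\<close>.\<close>

lemma (in wf_digraph) lin_span_outside_idempotents:
  fixes I :: "(('a, 'b) path \<Rightarrow>\<^sub>0 'k::field) set"
  assumes I: "path_ideal G I"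
  defines "A \<equiv> quotient_alg (path_algebra G) I" and "c \<equiv> coset (path_algebra G) I"
  shows "lin_span A {gmult A (gmult A u (c (Poly_Mapping.single (x, [], x) 1))) v | u x v.
            u \<in> gcarrier A \<and> x \<in> verts G - X \<and> v \<in> gcarrier A} = c ` leaving_sums G X"
    (is "lin_span A ?S = _")
proof (intro equalityI subsetI)
  note ops = path_coset_ops[OF I, folded A_def c_def]
  note Z = path_ideal_leaving_sums[of X, where 'c = 'k]
  have carr: "gcarrier A = c ` {p. Poly_Mapping.keys p \<subseteq> paths G}"
    by (simp add: A_def quotient_alg_simps c_def)
  have zero: "gzero A = c 0" by (simp add: A_def quotient_alg_simps c_def)
  let ?e = "\<lambda>x. Poly_Mapping.single (x, [], x) 1 :: ('a, 'b) path \<Rightarrow>\<^sub>0 'k"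
  have e: "Poly_Mapping.keys (?e x) \<subseteq> paths G" if "x \<in> verts G" for x
    using that by (auto simp: paths_simps)
  have prod: "gmult A (gmult A (c p) (c (?e x))) (c q) = c (p \<cdot> ?e x \<cdot> q)"
    if "x \<in> verts G" "Poly_Mapping.keys p \<subseteq> paths G" "Poly_Mapping.keys q \<subseteq> paths G" for x p q
    using that e[OF that(1)] path_mult_carrier[OF that(2) e[OF that(1)]] by (simp add: ops)
  {
    fix z assume "z \<in> lin_span A ?S"
    then show "z \<in> c ` leaving_sums G X"
    proof induction
      case zero
      show ?case unfolding \<open>gzero A = c 0\<close> using Z by (intro imageI) (simp add: path_ideal_def)
    next
      case (base s)
      then obtain p q x where *: "Poly_Mapping.keys p \<subseteq> paths G" "Poly_Mapping.keys q \<subseteq> paths G"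
          "x \<in> verts G" "x \<notin> X" "s = gmult A (gmult A (c p) (c (?e x))) (c q)"
        unfolding carr by blast
      have "?e x \<in> leaving_sums G X"
        using * wf_digraph.paths_simps[OF wellformed_induce_subgraph]
        by (auto simp: leaving_sums_def paths_simps)
      then have "p \<cdot> ?e x \<cdot> q \<in> leaving_sums G X"
        using Z * by (simp add: path_ideal_def)
      with * prod show ?case by simp
    next
      case (add x y)
      then obtain p q where "x = c p" "y = c q" "p \<in> leaving_sums G X" "q \<in> leaving_sums G X" by blast
      with Z show ?case by (auto simp: ops path_ideal_def)
    next
      case (scale x a)
      then obtain p where "x = c p" "p \<in> leaving_sums G X" by blast
      with Z show ?case by (auto simp: ops path_ideal_def)
    qed
  next
    fix z assume "z \<in> c ` leaving_sums G X"
    then obtain p where p: "z = c p" "Poly_Mapping.keys p \<subseteq> paths G - paths (G \<restriction> X)"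
      unfolding leaving_sums_def by blast
    have single: "c (Poly_Mapping.single s a) \<in> lin_span A ?S" if "s \<in> Poly_Mapping.keys p" for s a
    proof -
      obtain u w v where s: "s = (u, w, v)" by (metis prod_cases3)
      with that p(2) have "(u, w, v) \<in> paths G" "(u, w, v) \<notin> paths (G \<restriction> X)" by auto
      from paths_split_outside[OF this] obtain x w1 w2 where
        x: "x \<in> verts G" "x \<notin> X" "w = w1 @ w2" "(u, w1, x) \<in> paths G" "(x, w2, v) \<in> paths G" by blast
      let ?p = "Poly_Mapping.single (u, w1, x) a" and ?q = "Poly_Mapping.single (x, w2, v) (1::'k)"
      have "?p \<cdot> ?e x \<cdot> ?q = Poly_Mapping.single s a"
        by (simp add: s x(3) path_mult_single path_comp_def path_scale_def)
      moreover have k: "Poly_Mapping.keys ?p \<subseteq> paths G" "Poly_Mapping.keys ?q \<subseteq> paths G"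
        using x by auto
      moreover have "gmult A (gmult A (c ?p) (c (?e x))) (c ?q) \<in> ?S"
        using x k unfolding carr by blast
      ultimately show ?thesis using prod[OF x(1) k] lin_span.base[of _ ?S A] by simp
    qed
    have "c (\<Sum>s\<in>K. Poly_Mapping.single s (Poly_Mapping.lookup p s)) \<in> lin_span A ?S"
      if "finite K" "K \<subseteq> Poly_Mapping.keys p" for K
      using that
    proof (induction K)
      case empty
      then show ?case using lin_span.zero[of A ?S] by (simp add: zero)
    next
      case (insert s K)
      then show ?case using lin_span.add[of _ A ?S, OF single[of s]] by (simp add: ops(1)[symmetric])
    qed
    from this[OF finite_keys subset_refl] show "z \<in> lin_span A ?S"
      unfolding p(1) by (simp add: poly_mapping_sum_singles)
  }
qed

section \<open>The projection onto the paths inside \<open>X\<close>\<close>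

definition restrict_sum ::
  "('v, 'a) pre_digraph \<Rightarrow> 'v set \<Rightarrow> (('v, 'a) path \<Rightarrow>\<^sub>0 'k::field) \<Rightarrow> (('v, 'a) path \<Rightarrow>\<^sub>0 'k)" where
  "restrict_sum G X = Poly_Mapping.mapp (\<lambda>s c. c when s \<in> paths (G \<restriction> X))"

lemma lookup_restrict_sum:
  "Poly_Mapping.lookup (restrict_sum G X p) s = (Poly_Mapping.lookup p s when s \<in> paths (G \<restriction> X))"
  by (auto simp: restrict_sum_def lookup_mapp when_def in_keys_iff)

lemma keys_restrict_sum: "Poly_Mapping.keys (restrict_sum G X p) = Poly_Mapping.keys p \<inter> paths (G \<restriction> X)"
  by (auto simp: in_keys_iff lookup_restrict_sum)

lemma restrict_sum_simps:
  "restrict_sum G X 0 = 0"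
  "restrict_sum G X (p + q) = restrict_sum G X p + restrict_sum G X q"
  "restrict_sum G X (path_scale a p) = path_scale a (restrict_sum G X p)"
  by (rule poly_mapping_eqI; simp add: lookup_restrict_sum lookup_add when_def)+

lemma restrict_sum_id: "Poly_Mapping.keys p \<subseteq> paths (G \<restriction> X) \<Longrightarrow> restrict_sum G X p = p"
  by (rule poly_mapping_eqI) (auto simp: lookup_restrict_sum when_def in_keys_iff)

lemma restrict_sum_leaving: "p \<in> leaving_sums G X \<Longrightarrow> restrict_sum G X p = 0"
  by (rule poly_mapping_eqI) (auto simp: lookup_restrict_sum when_def in_keys_iff leaving_sums_def)

lemma minus_restrict_sum_leaving:
  "Poly_Mapping.keys p \<subseteq> paths G \<Longrightarrow> p - restrict_sum G X p \<in> leaving_sums G X"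
  by (auto simp: leaving_sums_def in_keys_iff lookup_minus lookup_restrict_sum when_def split: if_splits)

text \<open>Split each factor into its inside and leaving parts. The product of the inside parts
  stays inside, and all other terms lie in the ideal \<open>leaving_sums\<close>, which the
  projection kills.\<close>

lemma (in wf_digraph) restrict_sum_mult:
  assumes X: "X \<subseteq> verts G" and p: "Poly_Mapping.keys p \<subseteq> paths G" and q: "Poly_Mapping.keys q \<subseteq> paths G"
  shows "restrict_sum G X (p \<cdot> q) = restrict_sum G X p \<cdot> restrict_sum G X q"
proof -
  let ?r = "restrict_sum G X"
  note Z = path_ideal_leaving_sums[of X, where 'c = 'c]
  have k: "Poly_Mapping.keys (?r p) \<subseteq> paths G" "Poly_Mapping.keys (?r q) \<subseteq> paths G"
    using p q by (auto simp: keys_restrict_sum)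
  have "p \<cdot> q = (?r p + (p - ?r p)) \<cdot> (?r q + (q - ?r q))" by simp
  also have "\<dots> = ?r p \<cdot> ?r q + (?r p \<cdot> (q - ?r q) + (p - ?r p) \<cdot> (?r q + (q - ?r q)))"
    unfolding path_mult_add_left path_mult_add_right by (simp only: ac_simps)
  finally have *: "p \<cdot> q = ?r p \<cdot> ?r q + (?r p \<cdot> (q - ?r q) + (p - ?r p) \<cdot> q)" by simp
  have "p - ?r p \<in> leaving_sums G X" "q - ?r q \<in> leaving_sums G X"
    using p q by (auto intro: minus_restrict_sum_leaving)
  then have "?r p \<cdot> (q - ?r q) + (p - ?r p) \<cdot> q \<in> leaving_sums G X"
    using Z q k unfolding path_ideal_def by blast
  moreover have "?r (?r p \<cdot> ?r q) = ?r p \<cdot> ?r q"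
    by (intro restrict_sum_id path_mult_carrier) (auto simp: keys_restrict_sum)
  ultimately show ?thesis
    unfolding * restrict_sum_simps(2)[of G X "?r p \<cdot> ?r q"] by (simp only: restrict_sum_leaving add_0_right)
qed

lemma (in wf_digraph) restrict_sum_ideal_gen:
  assumes X: "X \<subseteq> verts G" and S: "\<forall>x\<in>S. Poly_Mapping.keys x \<subseteq> paths G"
    and J: "path_ideal (G \<restriction> X) J" "restrict_sum G X ` S \<subseteq> J"
    and x: "x \<in> ideal_gen (path_algebra G) S"
  shows "restrict_sum G X x \<in> J"
  using x
proof induction
  case zero
  then show ?case using J by (simp add: restrict_sum_simps path_ideal_def)
next
  case (base s)
  then show ?case using J by auto
next
  case (add x y)
  then show ?case using J by (simp add: restrict_sum_simps path_ideal_def)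
next
  case (scale x a)
  then show ?case using J by (simp add: restrict_sum_simps path_ideal_def)
next
  case (left a x)
  then have "Poly_Mapping.keys a \<subseteq> paths G" "Poly_Mapping.keys x \<subseteq> paths G"
    using path_ideal_gen[OF S] by (auto simp: path_ideal_def)
  then show ?case using J left restrict_sum_mult[OF X, of a x]
    by (auto simp: path_ideal_def keys_restrict_sum)
next
  case (right a x)
  then have "Poly_Mapping.keys a \<subseteq> paths G" "Poly_Mapping.keys x \<subseteq> paths G"
    using path_ideal_gen[OF S] by (auto simp: path_ideal_def)
  then show ?case using J right restrict_sum_mult[OF X, of x a]
    by (auto simp: path_ideal_def keys_restrict_sum)
qed

text \<open>Including the small path algebra into the large one and passing to both quotients is
  onto, since each \<open>p\<close> agrees with its projection modulo leaving paths. The kernel is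
  the part of \<open>I + leaving_sums G X\<close> supported inside \<open>X\<close>; the assumptions
  on \<open>J\<close> provide the two inclusions between \<open>J\<close> and this kernel, so
  \<open>J\<close> may be given by any generators.\<close>

lemma (in wf_digraph) restricted_presentation:
  fixes S J :: "(('a, 'b) path \<Rightarrow>\<^sub>0 'k::field) set"
  assumes X: "X \<subseteq> verts G" and S: "\<forall>x\<in>S. Poly_Mapping.keys x \<subseteq> paths G"
  defines "I \<equiv> ideal_gen (path_algebra G) S"
  defines "A \<equiv> quotient_alg (path_algebra G) I"
  assumes J: "path_ideal (G \<restriction> X) J" "restrict_sum G X ` S \<subseteq> J"
    and J': "J \<subseteq> {x + z | x z. x \<in> I \<and> z \<in> leaving_sums G X}"
  shows "graded_isomorphic (quotient_alg (path_algebra (G \<restriction> X)) J)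
           (quotient_alg A (coset (path_algebra G) I ` leaving_sums G X))"
proof -
  have I: "path_ideal G I" unfolding I_def by (rule path_ideal_gen[OF S])
  note Z = path_ideal_leaving_sums[of X, where 'c = 'k]
  let ?c = "coset (path_algebra G) I" and ?Z = "leaving_sums G X :: (('a, 'b) path \<Rightarrow>\<^sub>0 'k) set"
  let ?B = "quotient_alg A (?c ` ?Z)"
  define C where "C x = coset A (?c ` ?Z) (?c x)" for x
  note ops = double_coset_ops[OF I Z, folded A_def, folded C_def]
  have C_eq: "C x = C y \<longleftrightarrow> x - y \<in> {x + z | x z. x \<in> I \<and> z \<in> ?Z}" for x y
    unfolding C_def A_def by (rule double_coset_eq_iff[OF I Z])
  have sub: "paths (G \<restriction> X) \<subseteq> paths G" by (rule paths_restrict_subset[OF X])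
  have carrB: "gcarrier ?B = C ` {p. Poly_Mapping.keys p \<subseteq> paths G}"
    by (simp add: quotient_alg_simps A_def image_image C_def)
  have degB: "gdeg ?B n = C ` gdeg (path_algebra G) n" for n
    by (simp add: quotient_alg_simps A_def image_image C_def)
  have C_restrict: "C (restrict_sum G X p) = C p" if "Poly_Mapping.keys p \<subseteq> paths G" for p
  proof -
    have "0 \<in> I" using I by (simp add: path_ideal_def)
    moreover have "p - restrict_sum G X p = 0 + (p - restrict_sum G X p)" by simp
    ultimately have "C p = C (restrict_sum G X p)"
      unfolding C_eq using minus_restrict_sum_leaving[OF that] by blast
    then show ?thesis by simp
  qed
  have deg: "C ` gdeg (path_algebra (G \<restriction> X)) n = gdeg ?B n" for n
  proof (intro equalityI)
    show "C ` gdeg (path_algebra (G \<restriction> X)) n \<subseteq> gdeg ?B n"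
      unfolding degB using sub by (intro image_mono) auto
    show "gdeg ?B n \<subseteq> C ` gdeg (path_algebra (G \<restriction> X)) n"
    proof
      fix P assume "P \<in> gdeg ?B n"
      then obtain p where p: "P = C p" "p \<in> gdeg (path_algebra G) n" unfolding degB by blast
      then have "C (restrict_sum G X p) = P" "restrict_sum G X p \<in> gdeg (path_algebra (G \<restriction> X)) n"
        using C_restrict[of p] by (auto simp: keys_restrict_sum)
      then show "P \<in> C ` gdeg (path_algebra (G \<restriction> X)) n" by blast
    qed
  qed
  have surj: "C ` gcarrier (path_algebra (G \<restriction> X)) = gcarrier ?B"
  proof (intro equalityI)
    show "C ` gcarrier (path_algebra (G \<restriction> X)) \<subseteq> gcarrier ?B"
      unfolding carrB using sub by (intro image_mono) auto
    show "gcarrier ?B \<subseteq> C ` gcarrier (path_algebra (G \<restriction> X))"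
    proof
      fix P assume "P \<in> gcarrier ?B"
      then obtain p where p: "P = C p" "Poly_Mapping.keys p \<subseteq> paths G" unfolding carrB by blast
      then have "C (restrict_sum G X p) = P" "restrict_sum G X p \<in> gcarrier (path_algebra (G \<restriction> X))"
        using C_restrict[of p] by (auto simp: keys_restrict_sum)
      then show "P \<in> C ` gcarrier (path_algebra (G \<restriction> X))" by blast
    qed
  qed
  show ?thesis
  proof (rule quotient_path_algebra_isomorphic[OF J(1), of _ C])
    show "graded_hom (path_algebra (G \<restriction> X)) ?B C"
      unfolding graded_hom_def
    proof (intro conjI ballI allI)
      show "C (gzero (path_algebra (G \<restriction> X))) = gzero ?B"
        by (simp add: quotient_alg_simps A_def C_def)
      show "C ` gcarrier (path_algebra (G \<restriction> X)) \<subseteq> gcarrier ?B" using surj by simp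
      show "C ` gdeg (path_algebra (G \<restriction> X)) n \<subseteq> gdeg ?B n" for n using deg by simp
    next
      fix x y :: "('a, 'b) path \<Rightarrow>\<^sub>0 'k"
      assume "x \<in> gcarrier (path_algebra (G \<restriction> X))" "y \<in> gcarrier (path_algebra (G \<restriction> X))"
      then have k: "Poly_Mapping.keys x \<subseteq> paths G" "Poly_Mapping.keys y \<subseteq> paths G" using sub by auto
      show "C (gadd (path_algebra (G \<restriction> X)) x y) = gadd ?B (C x) (C y)"
        by (simp add: ops)
      show "C (gmult (path_algebra (G \<restriction> X)) x y) = gmult ?B (C x) (C y)"
        by (simp add: ops(3)[OF k])
      show "C (gscale (path_algebra (G \<restriction> X)) a x) = gscale ?B a (C x)" for a
        by (simp add: ops)
    qed
  next
    fix x y :: "('a, 'b) path \<Rightarrow>\<^sub>0 'k"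
    assume "Poly_Mapping.keys x \<subseteq> paths (G \<restriction> X)" "Poly_Mapping.keys y \<subseteq> paths (G \<restriction> X)"
    then have k: "Poly_Mapping.keys (x - y) \<subseteq> paths (G \<restriction> X)" using keys_diff[of x y] by blast
    show "C x = C y \<longleftrightarrow> x - y \<in> J"
      unfolding C_eq
    proof
      assume "x - y \<in> {x + z | x z. x \<in> I \<and> z \<in> ?Z}"
      then obtain i z where iz: "x - y = i + z" "i \<in> I" "z \<in> ?Z" by blast
      \<comment> \<open>The projection fixes \<open>x - y\<close>, which is supported inside
        \<open>X\<close>, and kills \<open>z\<close>; only the projection of \<open>i\<close>
        survives.\<close>
      have "x - y = restrict_sum G X (x - y)" using restrict_sum_id[OF k] by simp
      also have "\<dots> = restrict_sum G X i"
        unfolding iz(1) restrict_sum_simps restrict_sum_leaving[OF iz(3)] by simp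
      finally show "x - y \<in> J"
        using restrict_sum_ideal_gen[OF X S J] iz(2) unfolding I_def by simp
    qed (use J' in blast)
  qed (fact surj deg)+
qed

section \<open>Orthogonality of the relations\<close>

definition pairing :: "('p \<Rightarrow>\<^sub>0 'k::field) \<Rightarrow> ('p \<Rightarrow>\<^sub>0 'k) \<Rightarrow> 'k" where
  "pairing p q = (\<Sum>s\<in>Poly_Mapping.keys p. Poly_Mapping.lookup p s * Poly_Mapping.lookup q s)"

lemma pairing_superset:
  assumes "finite A" "Poly_Mapping.keys p \<subseteq> A"
  shows "pairing p q = (\<Sum>s\<in>A. Poly_Mapping.lookup p s * Poly_Mapping.lookup q s)"
  unfolding pairing_def
  by (rule sum.mono_neutral_left) (use assms in \<open>auto simp: in_keys_iff\<close>)

lemma pairing_commute: "pairing p q = pairing q p"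
  by (subst (1 2) pairing_superset[of "Poly_Mapping.keys p \<union> Poly_Mapping.keys q"])
    (auto simp: mult.commute)

lemma pairing_add_left: "pairing (p + p') q = pairing p q + pairing p' q"
  using Poly_Mapping.keys_add[of p p']
  by (subst (1 2 3) pairing_superset[of "Poly_Mapping.keys p \<union> Poly_Mapping.keys p'"])
    (auto simp: lookup_add distrib_right sum.distrib)

lemma pairing_scale_left: "pairing (path_scale c p) q = c * pairing p q"
  using keys_path_scale[of c p]
  by (subst pairing_superset[of "Poly_Mapping.keys p"])
    (auto simp: pairing_def sum_distrib_left mult.assoc)

lemma pairing_zero_left [simp]: "pairing 0 q = 0"
  by (simp add: pairing_def)

lemma pairing_diff_left: "pairing (p - p') q = pairing p q - pairing p' q"
  using pairing_add_left[of "p - p'" p' q] by simp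

lemma pairing_sum_left: "pairing (\<Sum>i\<in>A. f i) q = (\<Sum>i\<in>A. pairing (f i) q)"
  by (induction A rule: infinite_finite_induct) (simp_all add: pairing_add_left)

lemma pairing_single_left [simp]: "pairing (Poly_Mapping.single s c) q = c * Poly_Mapping.lookup q s"
  by (subst pairing_superset[of "{s}"]) auto

text \<open>Lengths add under composition, so if no path in \<open>x\<close> is shorter than
  \<open>w\<close>, only the trivial path at \<open>u\<close> in \<open>a\<close> can contribute.
  The condition on the keys of \<open>a\<close> rules out triples with an empty word and different
  ends.\<close>

lemma lookup_path_mult_left:
  fixes a x :: "('v, 'a) path \<Rightarrow>\<^sub>0 'k::field"
  assumes a: "Poly_Mapping.keys a \<subseteq> paths G"
    and x: "\<And>s. s \<in> Poly_Mapping.keys x \<Longrightarrow> length w \<le> length (fst (snd s))"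
  shows "Poly_Mapping.lookup (a \<cdot> x) (u, w, v)
       = Poly_Mapping.lookup a (u, [], u) * Poly_Mapping.lookup x (u, w, v)"
proof -
  have "(\<Sum>t\<in>Poly_Mapping.keys x. Poly_Mapping.lookup a s * Poly_Mapping.lookup x t *
            Poly_Mapping.lookup (path_comp s t) (u, w, v))
      = (Poly_Mapping.lookup a s * Poly_Mapping.lookup x (u, w, v) when s = (u, [], u))"
    if s: "s \<in> Poly_Mapping.keys a" for s
  proof -
    have "Poly_Mapping.lookup (path_comp s t :: _ \<Rightarrow>\<^sub>0 'k) (u, w, v) = (1 when s = (u, [], u) \<and> t = (u, w, v))"
      if t: "t \<in> Poly_Mapping.keys x" for t
    proof -
      obtain u1 w1 v1 u2 w2 v2 where st: "s = (u1, w1, v1)" "t = (u2, w2, v2)" by (metis prod_cases3)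
      have "u1 = v1" if "w1 = []"
        using a s st that by (auto simp: paths_def pre_digraph.awalk_def pre_digraph.cas.simps)
      moreover have "length w \<le> length w2" using x[OF t] st by simp
      ultimately show ?thesis
        unfolding st path_comp_def by (auto simp: lookup_single when_def)
    qed
    then have "(\<Sum>t\<in>Poly_Mapping.keys x. Poly_Mapping.lookup a s * Poly_Mapping.lookup x t *
            Poly_Mapping.lookup (path_comp s t) (u, w, v))
        = (\<Sum>t\<in>Poly_Mapping.keys x. if t = (u, w, v) then
            (Poly_Mapping.lookup a s * Poly_Mapping.lookup x t when s = (u, [], u)) else 0)"
      by (intro sum.cong refl) (auto simp: when_def)
    then show ?thesis by (auto simp: in_keys_iff when_def)
  qed
  then have "Poly_Mapping.lookup (a \<cdot> x) (u, w, v) = (\<Sum>s\<in>Poly_Mapping.keys a.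
      if s = (u, [], u) then Poly_Mapping.lookup a s * Poly_Mapping.lookup x (u, w, v) else 0)"
    unfolding path_mult_def by (simp add: lookup_sum when_def)
  then show ?thesis by (auto simp: in_keys_iff)
qed

lemma lookup_path_mult_right:
  fixes a x :: "('v, 'a) path \<Rightarrow>\<^sub>0 'k::field"
  assumes a: "Poly_Mapping.keys a \<subseteq> paths G"
    and x: "\<And>s. s \<in> Poly_Mapping.keys x \<Longrightarrow> length w \<le> length (fst (snd s))"
  shows "Poly_Mapping.lookup (x \<cdot> a) (u, w, v)
       = Poly_Mapping.lookup x (u, w, v) * Poly_Mapping.lookup a (v, [], v)"
proof -
  have "(\<Sum>t\<in>Poly_Mapping.keys a. Poly_Mapping.lookup x s * Poly_Mapping.lookup a t *
            Poly_Mapping.lookup (path_comp s t) (u, w, v))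
      = (Poly_Mapping.lookup x s * Poly_Mapping.lookup a (v, [], v) when s = (u, w, v))"
    if s: "s \<in> Poly_Mapping.keys x" for s
  proof -
    have "Poly_Mapping.lookup (path_comp s t :: _ \<Rightarrow>\<^sub>0 'k) (u, w, v) = (1 when s = (u, w, v) \<and> t = (v, [], v))"
      if t: "t \<in> Poly_Mapping.keys a" for t
    proof -
      obtain u1 w1 v1 u2 w2 v2 where st: "s = (u1, w1, v1)" "t = (u2, w2, v2)" by (metis prod_cases3)
      have "u2 = v2" if "w2 = []"
        using a t st that by (auto simp: paths_def pre_digraph.awalk_def pre_digraph.cas.simps)
      moreover have "length w \<le> length w1" using x[OF s] st by simp
      ultimately show ?thesis
        unfolding st path_comp_def by (auto simp: lookup_single when_def)
    qed
    then have "(\<Sum>t\<in>Poly_Mapping.keys a. Poly_Mapping.lookup x s * Poly_Mapping.lookup a t *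
            Poly_Mapping.lookup (path_comp s t) (u, w, v))
        = (\<Sum>t\<in>Poly_Mapping.keys a. if t = (v, [], v) then
            (Poly_Mapping.lookup x s * Poly_Mapping.lookup a t when s = (u, w, v)) else 0)"
      by (intro sum.cong refl) (auto simp: when_def)
    then show ?thesis by (auto simp: in_keys_iff when_def)
  qed
  then have "Poly_Mapping.lookup (x \<cdot> a) (u, w, v) = (\<Sum>s\<in>Poly_Mapping.keys x.
      if s = (u, w, v) then Poly_Mapping.lookup x s * Poly_Mapping.lookup a (v, [], v) else 0)"
    unfolding path_mult_def by (simp add: lookup_sum when_def)
  then show ?thesis by (auto simp: in_keys_iff)
qed

text \<open>
  A direction \<open>(True, i)\<close> or \<open>(False, i)\<close> is a step by \<open>\<epsilon>\<^sub>i\<close> or \<open>-\<epsilon>\<^sub>i\<close>. In terms of directions the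
  relations of degree two between distinct coordinates have the same form for all signs.
\<close>

fun step :: "(nat \<Rightarrow> int) \<Rightarrow> bool \<times> nat \<Rightarrow> (nat \<Rightarrow> int)" where
  "step x (True, i) = inc x i"
| "step x (False, i) = dec x i"

fun step_arrow :: "(nat \<Rightarrow> int) \<Rightarrow> bool \<times> nat \<Rightarrow> cube_arrow" where
  "step_arrow x (True, i) = Up x i"
| "step_arrow x (False, i) = Down x i"

definition two_step :: "(nat \<Rightarrow> int) \<Rightarrow> bool \<times> nat \<Rightarrow> bool \<times> nat \<Rightarrow> (nat \<Rightarrow> int, cube_arrow) path" where
  "two_step x d e = (x, [step_arrow x d, step_arrow (step x d) e], step (step x d) e)"

abbreviation two_step_sum :: "(nat \<Rightarrow> int) \<Rightarrow> bool \<times> nat \<Rightarrow> bool \<times> nat \<Rightarrow> 'k::field cube_path_sum" where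
  "two_step_sum x d e \<equiv> Poly_Mapping.single (two_step x d e) 1"

abbreviation loop_sum :: "(nat \<Rightarrow> int) \<Rightarrow> nat \<Rightarrow> 'k::field cube_path_sum" where
  "loop_sum x i \<equiv> two_step_sum x (False, i) (True, i) + two_step_sum x (True, i) (False, i)"

lemma step_arrow_inject [simp]: "step_arrow x d = step_arrow y e \<longleftrightarrow> x = y \<and> d = e"
  by (cases "(x, d)" rule: step_arrow.cases; cases "(y, e)" rule: step_arrow.cases) auto

lemma step_arrow_ends [simp]:
  "arrow_source (step_arrow x d) = x" "arrow_target (step_arrow x d) = step x d"
  by (cases "(x, d)" rule: step_arrow.cases; simp)+

lemma two_step_inject [simp]: "two_step x d e = two_step y d' e' \<longleftrightarrow> x = y \<and> d = d' \<and> e = e'"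
  by (auto simp: two_step_def)

lemma step_commute: "step (step x d) e = step (step x e) d"
  by (cases "(x, d)" rule: step.cases; cases "(x, e)" rule: step.cases) (auto simp: inc_def dec_def)

lemma step_loop: "snd d = snd e \<Longrightarrow> d \<noteq> e \<Longrightarrow> step (step x d) e = x"
  by (cases "(x, d)" rule: step.cases; cases "(x, e)" rule: step.cases) (auto simp: inc_def dec_def)

lemma step_mem: "x \<in> zlattice r \<Longrightarrow> snd d \<in> {1..r} \<Longrightarrow> step x d \<in> zlattice r"
  by (cases "(x, d)" rule: step.cases) (auto intro: inc_mem dec_mem)

lemma step_arrow_in_arcs [simp]:
  "step_arrow x d \<in> arcs (cube_quiver r) \<longleftrightarrow> x \<in> zlattice r \<and> snd d \<in> {1..r}"
  by (cases "(x, d)" rule: step_arrow.cases) (auto simp: cube_quiver_def)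

lemma arcs_cube_quiver:
  assumes "a \<in> arcs (cube_quiver r)"
  obtains x d where "a = step_arrow x d" "x \<in> zlattice r" "snd d \<in> {1..r}"
proof -
  from assms consider x i where "a = Up x i" "x \<in> zlattice r" "i \<in> {1..r}"
    | x i where "a = Down x i" "x \<in> zlattice r" "i \<in> {1..r}"
    by (auto simp: cube_quiver_def)
  then show thesis
    by cases (use that[of _ "(True, _)"] that[of _ "(False, _)"] in auto)
qed

lemma cube_quiver_simps [simp]:
  "verts (cube_quiver r) = zlattice r" "tail (cube_quiver r) = arrow_source"
  "head (cube_quiver r) = arrow_target"
  by (simp_all add: cube_quiver_def)

lemma wf_cube_quiver: "wf_digraph (cube_quiver r)"
  by unfold_locales (auto elim!: arcs_cube_quiver simp: step_mem)

lemmas cube_paths_simps = wf_digraph.paths_simps[OF wf_cube_quiver]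

lemma two_step_in_paths [simp]:
  "two_step x d e \<in> paths (cube_quiver r) \<longleftrightarrow> x \<in> zlattice r \<and> snd d \<in> {1..r} \<and> snd e \<in> {1..r}"
  by (auto simp: two_step_def cube_paths_simps step_mem)

lemma two_step_simps [simp]:
  "fst (two_step x d e) = x" "length (fst (snd (two_step x d e))) = 2"
  "snd (snd (two_step x d e)) = step (step x d) e"
  by (simp_all add: two_step_def)

lemma path_length_two:
  assumes "s \<in> paths (cube_quiver r)" "length (fst (snd s)) = 2"
  obtains x d e where "s = two_step x d e" "x \<in> zlattice r" "snd d \<in> {1..r}" "snd e \<in> {1..r}"
proof -
  obtain u w v where s: "s = (u, w, v)" by (metis prod_cases3)
  with assms obtain a b where w: "w = [a, b]" by (auto simp: numeral_2_eq_2 length_Suc_conv)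
  then have ab: "a \<in> arcs (cube_quiver r)" "b \<in> arcs (cube_quiver r)" "u = arrow_source a"
    "arrow_target a = arrow_source b" "arrow_target b = v"
    using assms s by (auto simp: cube_paths_simps)
  obtain x d where a: "a = step_arrow x d" "x \<in> zlattice r" "snd d \<in> {1..r}"
    using ab(1) by (rule arcs_cube_quiver)
  obtain y e where b: "b = step_arrow y e" "snd e \<in> {1..r}"
    using ab(2) by (rule arcs_cube_quiver)
  have "s = two_step x d e" using s w ab a b by (simp add: two_step_def)
  then show thesis using that a b by blast
qed

lemma arrow_products:
  "up x i \<cdot> up (inc x i) j = two_step_sum x (True, i) (True, j)"
  "up x i \<cdot> down (inc x i) j = two_step_sum x (True, i) (False, j)"
  "down x i \<cdot> up (dec x i) j = two_step_sum x (False, i) (True, j)"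
  "down x i \<cdot> down (dec x i) j = two_step_sum x (False, i) (False, j)"
  by (simp_all add: up_def down_def two_step_def path_mult_single path_comp_def path_scale_simps)

section \<open>The relations of both algebras in terms of directions, and their
  orthogonality\<close>

lemma U_relations_cases:
  fixes u :: "'k::field cube_path_sum"
  assumes "u \<in> U_relations r"
  obtains (square) x d where "x \<in> zlattice r" "snd d \<in> {1..r}" "u = two_step_sum x d d"
    | (distinct) x d e where "x \<in> zlattice r" "snd d \<in> {1..r}" "snd e \<in> {1..r}" "snd d \<noteq> snd e"
        "u = two_step_sum x d e + two_step_sum x e d"
    | (loop) x i where "x \<in> zlattice r" "1 \<le> i" "i < r" "u = loop_sum x i - loop_sum x (i + 1)"
  using assms unfolding U_relations_def arrow_products
  by (elim UnE CollectE exE conjE)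
     (use square[of _ "(_, _)"] distinct[of _ "(_, _)" "(_, _)"] loop in \<open>force+\<close>)

lemma U_relations_intros:
  fixes x :: "nat \<Rightarrow> int"
  assumes x: "x \<in> zlattice r"
  shows "snd d \<in> {1..r} \<Longrightarrow> two_step_sum x d d \<in> U_relations r"
    and "snd d \<in> {1..r} \<Longrightarrow> snd e \<in> {1..r} \<Longrightarrow> snd d \<noteq> snd e \<Longrightarrow>
           two_step_sum x d e + two_step_sum x e d \<in> U_relations r"
    and "1 \<le> i \<Longrightarrow> i < r \<Longrightarrow> loop_sum x i - loop_sum x (i + 1) \<in> U_relations r"
proof -
  have square: "two_step_sum x (True, i) (True, i) \<in> U_relations r"
      "two_step_sum x (False, i) (False, i) \<in> U_relations r" if "i \<in> {1..r}" for i
    unfolding U_relations_def arrow_products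
    by (rule UnI1, rule UnI1, rule UnI1, rule UnI1, rule UnI1, use x that in blast)
       (rule UnI1, rule UnI1, rule UnI1, rule UnI1, rule UnI2, use x that in blast)
  have distinct: "two_step_sum x (True, i) (True, j) + two_step_sum x (True, j) (True, i) \<in> U_relations r"
      "two_step_sum x (False, i) (False, j) + two_step_sum x (False, j) (False, i) \<in> U_relations r"
      "two_step_sum x (True, i) (False, j) + two_step_sum x (False, j) (True, i) \<in> U_relations r"
    if "i \<in> {1..r}" "j \<in> {1..r}" "i \<noteq> j" for i j
    unfolding U_relations_def arrow_products
    by (rule UnI1, rule UnI1, rule UnI1, rule UnI2, use x that in blast)
       (rule UnI1, rule UnI1, rule UnI2, use x that in blast,
        rule UnI1, rule UnI2, use x that in blast)
  show "two_step_sum x d d \<in> U_relations r" if "snd d \<in> {1..r}"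
    using that square by (cases "(x, d)" rule: step.cases) simp_all
  show "two_step_sum x d e + two_step_sum x e d \<in> U_relations r"
    if "snd d \<in> {1..r}" "snd e \<in> {1..r}" "snd d \<noteq> snd e"
  proof -
    obtain b i b' j where de: "d = (b, i)" "e = (b', j)" by fastforce
    with that have ij: "i \<in> {1..r}" "j \<in> {1..r}" "i \<noteq> j" "j \<noteq> i" by auto
    show ?thesis
      unfolding de
      by (cases b; cases b')
        (use distinct[OF ij(1,2,3)] distinct[OF ij(2,1,4)] in \<open>simp_all add: add.commute\<close>)
  qed
  show "loop_sum x i - loop_sum x (i + 1) \<in> U_relations r" if "1 \<le> i" "i < r"
    unfolding U_relations_def arrow_products by (rule UnI2) (use x that in blast)
qed

text \<open>Ups commute with downs also for \<open>i = j\<close>, so \<open>commute\<close> covers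
  opposite directions in one coordinate, whereas for \<open>U_relations\<close> these paths occur
  only in \<open>loop\<close>.\<close>

lemma V_relations_cases:
  fixes p :: "'k::field cube_path_sum"
  assumes "p \<in> V_relations r"
  obtains (commute) x d e where "d \<noteq> e" "p = two_step_sum x d e - two_step_sum x e d"
    | (sum) x where "p = (\<Sum>i = 1..r. two_step_sum x (False, i) (True, i))"
proof -
  consider b x i j where "i \<noteq> j" "p = two_step_sum x (b, i) (b, j) - two_step_sum x (b, j) (b, i)"
    | x i j where "p = two_step_sum x (True, i) (False, j) - two_step_sum x (False, j) (True, i)"
    | x where "p = (\<Sum>i = 1..r. two_step_sum x (False, i) (True, i))"
    using assms unfolding V_relations_def arrow_products by (elim UnE CollectE exE conjE)
  then show thesis
    by cases (use commute[of "(_, _)" "(_, _)"] sum in blast)+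
qed

lemma V_ideal_commute:
  assumes x: "x \<in> zlattice r" and d: "snd d \<in> {1..r}" and e: "snd e \<in> {1..r}"
  shows "(two_step_sum x d e - two_step_sum x e d :: 'k::field cube_path_sum) \<in> V_ideal r"
proof (cases "d = e")
  case True
  have "0 \<in> V_ideal r" unfolding V_ideal_def using ideal_gen.zero by (metis path_algebra_simps(2))
  then show ?thesis by (simp add: True)
next
  case False
  let ?p = "\<lambda>d e. two_step_sum x d e - two_step_sum x e d :: 'k cube_path_sum"
  have V: "p \<in> V_ideal r" if "p \<in> V_relations r" for p :: "'k cube_path_sum"
    unfolding V_ideal_def by (rule ideal_gen.base[OF that])
  have same: "?p (True, i) (True, j) \<in> V_relations r" "?p (False, i) (False, j) \<in> V_relations r"
    if "i \<in> {1..r}" "j \<in> {1..r}" "i \<noteq> j" for i j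
    unfolding V_relations_def arrow_products
    by (rule UnI1, rule UnI1, rule UnI1, use x that in blast)
       (rule UnI1, rule UnI1, rule UnI2, use x that in blast)
  have mixed: "?p (True, i) (False, j) \<in> V_relations r" if "i \<in> {1..r}" "j \<in> {1..r}" for i j
    unfolding V_relations_def arrow_products
    by (rule UnI1, rule UnI2, use x that in blast)
  have mixed': "?p (False, j) (True, i) \<in> V_ideal r" if "i \<in> {1..r}" "j \<in> {1..r}" for i j
    using path_ideal_uminus[OF path_ideal_V V[OF mixed[OF that]]] by simp
  obtain b i b' j where de: "d = (b, i)" "e = (b', j)" by fastforce
  then have ij: "i \<in> {1..r}" "j \<in> {1..r}" "b = b' \<Longrightarrow> i \<noteq> j" using d e False by auto
  show ?thesis
    unfolding de
    by (cases b; cases b') (use ij in \<open>simp_all add: V same mixed mixed'\<close>)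
qed

lemma V_ideal_sum:
  "x \<in> zlattice r \<Longrightarrow> (\<Sum>i = 1..r. two_step_sum x (False, i) (True, i)) \<in> V_ideal r"
  unfolding V_ideal_def
  by (rule ideal_gen.base) (auto simp: V_relations_def arrow_products)

lemma keys_add_cases: "s \<in> Poly_Mapping.keys (p + q) \<Longrightarrow> s \<in> Poly_Mapping.keys p \<or> s \<in> Poly_Mapping.keys q"
  using Poly_Mapping.keys_add[of p q] by blast

lemma keys_diff_cases: "s \<in> Poly_Mapping.keys (p - q) \<Longrightarrow> s \<in> Poly_Mapping.keys p \<or> s \<in> Poly_Mapping.keys q"
  using keys_diff[of p q] by blast

text \<open>Common end points are what lets multiplication by a path sum act on all relevant
  coefficients by one scalar in \<open>pairing_V_ideal\<close>.\<close>

lemma U_relations_keys: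
  fixes u :: "'k::field cube_path_sum"
  assumes "u \<in> U_relations r"
  obtains x y where "\<And>s. s \<in> Poly_Mapping.keys u \<Longrightarrow>
    s \<in> paths (cube_quiver r) \<and> fst s = x \<and> snd (snd s) = y \<and> length (fst (snd s)) = 2"
  using assms
proof (cases rule: U_relations_cases)
  case (square x d)
  show thesis
  proof (rule that[of x "step (step x d) d"])
    fix s assume "s \<in> Poly_Mapping.keys u"
    then have "s = two_step x d d" by (simp add: square(3))
    then show "s \<in> paths (cube_quiver r) \<and> fst s = x \<and> snd (snd s) = step (step x d) d \<and>
        length (fst (snd s)) = 2"
      using square(1,2) by simp
  qed
next
  case (distinct x d e)
  show thesis
  proof (rule that[of x "step (step x d) e"])
    fix s assume "s \<in> Poly_Mapping.keys u"
    from keys_add_cases[OF this[unfolded distinct(5)]]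
    consider "s = two_step x d e" | "s = two_step x e d" by fastforce
    then show "s \<in> paths (cube_quiver r) \<and> fst s = x \<and> snd (snd s) = step (step x d) e \<and>
        length (fst (snd s)) = 2"
      by cases (use distinct(1-3) step_commute[of x d e] in simp_all)
  qed
next
  case (loop x i)
  have loop_keys: "s = two_step x (False, j) (True, j) \<or> s = two_step x (True, j) (False, j)"
    if "s \<in> Poly_Mapping.keys (loop_sum x j :: 'k cube_path_sum)" for s j
    using keys_add_cases[OF that] by simp
  have return: "step (step x (False, j)) (True, j) = x" "step (step x (True, j)) (False, j) = x" for j
    by (rule step_loop; simp)+
  show thesis
  proof (rule that[of x x])
    fix s assume "s \<in> Poly_Mapping.keys u"
    from keys_diff_cases[OF this[unfolded loop(4)]]
    obtain j where "j = i \<or> j = i + 1" and s: "s \<in> Poly_Mapping.keys (loop_sum x j :: 'k cube_path_sum)"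
      by blast
    then have "j \<in> {1..r}" using loop by auto
    with loop_keys[OF s] show "s \<in> paths (cube_quiver r) \<and> fst s = x \<and> snd (snd s) = x \<and>
        length (fst (snd s)) = 2"
      by (elim disjE) (use loop(1) return in \<open>simp_all del: step.simps\<close>)
  qed
qed

text \<open>This is orthogonality to the commutators among the \<open>V_relations\<close>:
  anticommutators and loop sums are symmetric in the two directions, and squares vanish at both
  paths when \<open>d \<noteq> e\<close>.\<close>

lemma lookup_U_relations_commute:
  assumes "u \<in> U_relations r" "d \<noteq> e"
  shows "Poly_Mapping.lookup u (two_step x d e) = Poly_Mapping.lookup u (two_step x e d)"
  using assms(1)
proof (cases rule: U_relations_cases)
  case (square y d')
  then show ?thesis using assms(2) by (auto simp: lookup_single when_def)
next
  case (distinct y d' e')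
  then show ?thesis by (simp add: lookup_add lookup_single conj_ac add.commute)
next
  case (loop y i)
  then show ?thesis by (simp add: lookup_add lookup_minus lookup_single conj_ac add.commute)
qed

lemma pairing_V_relations:
  fixes p u :: "'k::field cube_path_sum"
  assumes "p \<in> V_relations r" "u \<in> U_relations r"
  shows "pairing p u = 0"
  using assms(1)
proof (cases rule: V_relations_cases)
  case (commute x d e)
  then show ?thesis
    using lookup_U_relations_commute[OF assms(2) commute(1)] by (simp add: pairing_diff_left)
next
  case (sum x)
  then have *: "pairing p u = (\<Sum>i = 1..r. Poly_Mapping.lookup u (two_step x (False, i) (True, i)))"
    by (simp add: pairing_sum_left)
  from assms(2) show ?thesis
  proof (cases rule: U_relations_cases)
    case (square y d)
    then show ?thesis unfolding * by (intro sum.neutral) (auto simp: lookup_single when_def)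
  next
    case (distinct y d e)
    then show ?thesis unfolding * by (intro sum.neutral) (auto simp: lookup_add lookup_single when_def)
  next
    case (loop y j)
    \<comment> \<open>A loop sum contains exactly one down-then-up path, so the relation contributes
      1 at \<open>j\<close> and -1 at \<open>j + 1\<close>. As \<open>j < r\<close>, both indices
      are in range and cancel.\<close>
    then have "pairing p u = (\<Sum>i = 1..r. (if i = j then (if x = y then 1 else 0) else 0)
        - (if i = j + 1 then (if x = y then 1 else 0) else 0))"
      unfolding * by (intro sum.cong refl) (simp add: lookup_add lookup_minus lookup_single when_def)
    also have "\<dots> = 0" using loop by (simp add: sum_subtractf)
    finally show ?thesis .
  qed
qed

text \<open>Members of the ideal have only paths of length at least 2, so in degree two multiplying
  by \<open>a\<close> sees just the trivial-path coefficients of \<open>a\<close>. As all paths of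
  \<open>u\<close> share their ends, the pairing is merely scaled, and vanishing is inherited from
  the generators.\<close>

lemma pairing_V_ideal:
  fixes p u :: "'k::field cube_path_sum"
  assumes p: "p \<in> V_ideal r" and u: "u \<in> U_relations r"
  shows "pairing p u = 0"
proof -
  obtain y z where yz: "\<And>s. s \<in> Poly_Mapping.keys u \<Longrightarrow>
      s \<in> paths (cube_quiver r) \<and> fst s = y \<and> snd (snd s) = z \<and> length (fst (snd s)) = 2"
    using U_relations_keys[OF u] by metis
  \<comment> \<open>Summing over the support of \<open>u\<close> instead of the ideal element
    restricts attention to paths from \<open>y\<close> to \<open>z\<close> of length two.\<close>
  have right_keys: "pairing q u = (\<Sum>s\<in>Poly_Mapping.keys u. Poly_Mapping.lookup u s * Poly_Mapping.lookup q s)" for q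
    by (subst pairing_commute) (simp add: pairing_def)
  show ?thesis
    using p unfolding V_ideal_def
  proof induction
    case (base s)
    then show ?case using pairing_V_relations[OF _ u] by simp
  next
    case (left a x)
    then have a: "Poly_Mapping.keys a \<subseteq> paths (cube_quiver r)" and x: "x \<in> V_ideal r"
      by (simp_all add: V_ideal_def)
    have "pairing (a \<cdot> x) u = Poly_Mapping.lookup a (y, [], y) * pairing x u"
      unfolding right_keys sum_distrib_left
    proof (intro sum.cong refl)
      fix s assume s: "s \<in> Poly_Mapping.keys u"
      obtain w where w: "s = (y, w, z)" "length w = 2" using yz[OF s] by (cases s) auto
      then show "Poly_Mapping.lookup u s * Poly_Mapping.lookup (a \<cdot> x) s
          = Poly_Mapping.lookup a (y, [], y) * (Poly_Mapping.lookup u s * Poly_Mapping.lookup x s)"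
        using lookup_path_mult_left[OF a, of x w y z] V_ideal_keys[OF x] by (simp add: mult_ac)
    qed
    with left show ?case by simp
  next
    case (right a x)
    then have a: "Poly_Mapping.keys a \<subseteq> paths (cube_quiver r)" and x: "x \<in> V_ideal r"
      by (simp_all add: V_ideal_def)
    have "pairing (x \<cdot> a) u = Poly_Mapping.lookup a (z, [], z) * pairing x u"
      unfolding right_keys sum_distrib_left
    proof (intro sum.cong refl)
      fix s assume s: "s \<in> Poly_Mapping.keys u"
      obtain w where w: "s = (y, w, z)" "length w = 2" using yz[OF s] by (cases s) auto
      then show "Poly_Mapping.lookup u s * Poly_Mapping.lookup (x \<cdot> a) s
          = Poly_Mapping.lookup a (z, [], z) * (Poly_Mapping.lookup u s * Poly_Mapping.lookup x s)"
        using lookup_path_mult_right[OF a, of x w y z] V_ideal_keys[OF x] by (simp add: mult_ac)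
    qed
    with right show ?case by simp
  qed (simp_all add: pairing_add_left pairing_scale_left)
qed

section \<open>The orthogonal complement of the relations inside \<open>X\<close>\<close>

text \<open>Modulo \<open>I\<close> all \<open>f i\<close> coincide, so the sum reduces to the total
  weight times any one of them. It vanishes if the weight is zero or if one, hence each,
  \<open>f i\<close> lies in \<open>I\<close>.\<close>

lemma sum_weighted_in_path_ideal:
  assumes I: "path_ideal G I" and "finite A" "a \<in> A"
    and diff: "\<And>i j. i \<in> A \<Longrightarrow> j \<in> A \<Longrightarrow> f i - f j \<in> I"
    and c: "(\<Sum>i\<in>A. c i) = 0 \<or> (\<exists>i\<in>A. f i \<in> I)"
  shows "(\<Sum>i\<in>A. path_scale (c i) (f i)) \<in> I"
proof -
  have "(\<Sum>i\<in>A. path_scale (c i) (f i))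
      = (\<Sum>i\<in>A. path_scale (c i) (f i - f a)) + path_scale (\<Sum>i\<in>A. c i) (f a)"
    by (rule poly_mapping_eqI)
      (simp add: lookup_add lookup_sum lookup_minus right_diff_distrib sum_subtractf sum_distrib_right)
  moreover have "(\<Sum>i\<in>A. path_scale (c i) (f i - f a)) \<in> I"
    using I diff[OF _ \<open>a \<in> A\<close>] by (intro path_ideal_sum[OF I]) (simp add: path_ideal_def)
  moreover have "path_scale (\<Sum>i\<in>A. c i) (f a) \<in> I"
    using c
  proof
    assume "(\<Sum>i\<in>A. c i) = 0"
    then show ?thesis using I by (simp add: path_scale_simps path_ideal_def)
  next
    assume "\<exists>i\<in>A. f i \<in> I"
    then obtain i where "i \<in> A" "f i \<in> I" by blast
    then have "f i - (f i - f a) \<in> I" using diff \<open>a \<in> A\<close> by - (rule path_ideal_diff[OF I])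
    then show ?thesis using I by (simp add: path_ideal_def)
  qed
  ultimately show ?thesis using I by (simp add: path_ideal_def)
qed

fun direction :: "cube_arrow \<Rightarrow> bool \<times> nat" where
  "direction (Up x i) = (True, i)"
| "direction (Down x i) = (False, i)"

text \<open>
  Two paths of length two have the same label iff they occur in a common relation of \<open>U\<^sub>r\<close>, up to
  the chains of relations linking all the paths from a vertex to itself.
\<close>

definition label :: "(nat \<Rightarrow> int, cube_arrow) path \<Rightarrow> (nat \<Rightarrow> int) \<times> (bool \<times> nat) set" where
  "label s = (fst s, let D = direction ` set (fst (snd s)) in if inj_on snd D then D else {})"

lemma direction_step_arrow [simp]: "direction (step_arrow x d) = d"
  by (cases "(x, d)" rule: step_arrow.cases) auto

lemma label_two_step:
  "label (two_step x d e) = (x, if snd d = snd e \<and> d \<noteq> e then {} else {d, e})"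
proof -
  have "inj_on snd {d, e} \<longleftrightarrow> \<not> (snd d = snd e \<and> d \<noteq> e)" by (auto simp: inj_on_def)
  then show ?thesis by (simp add: label_def two_step_def)
qed

text \<open>Here \<open>T\<close> stands for \<open>W\<^sup>\<bottom> + A\<^sup>\<bottom>\<close>,
  later instantiated by \<open>U_ideal r\<close> plus \<open>leaving_sums\<close>, and
  \<open>q\<close> for a generator of the ideal defining the quadratic dual. The aim is
  \<open>q \<in> T\<close>, the harder inclusion.\<close>

context
  fixes r :: nat and X :: "(nat \<Rightarrow> int) set" and T :: "'k::field cube_path_sum set" and q :: "'k cube_path_sum"
  assumes X: "X \<subseteq> zlattice r"
    and T: "path_ideal (cube_quiver r) T"
    and U: "U_relations r \<subseteq> T"
    and leaving: "leaving_sums (cube_quiver r) X \<subseteq> T"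
    and q: "Poly_Mapping.keys q \<subseteq> {(u, w, v) \<in> paths (cube_quiver r \<restriction> X). length w = 2}"
    and orth: "\<And>p. p \<in> V_ideal r \<Longrightarrow>
      Poly_Mapping.keys p \<subseteq> {(u, w, v) \<in> paths (cube_quiver r \<restriction> X). length w = 2} \<Longrightarrow> pairing p q = 0"
begin

abbreviation (input) inside :: "(nat \<Rightarrow> int, cube_arrow) path \<Rightarrow> bool" where
  "inside s \<equiv> s \<in> paths (cube_quiver r \<restriction> X)"

lemma keys_length_two:
  "Poly_Mapping.keys (p :: 'k cube_path_sum) \<subseteq> {(u, w, v) \<in> paths (cube_quiver r \<restriction> X). length w = 2} \<longleftrightarrow>
   (\<forall>s\<in>Poly_Mapping.keys p. inside s \<and> length (fst (snd s)) = 2)"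
  by auto

lemma orth_commute:
  assumes x: "x \<in> zlattice r" "snd d \<in> {1..r}" "snd e \<in> {1..r}"
    and "inside (two_step x d e)" "inside (two_step x e d)"
  shows "Poly_Mapping.lookup q (two_step x d e) = Poly_Mapping.lookup q (two_step x e d)"
proof -
  let ?p = "two_step_sum x d e - two_step_sum x e d :: 'k cube_path_sum"
  have "inside s \<and> length (fst (snd s)) = 2" if "s \<in> Poly_Mapping.keys ?p" for s
    using keys_diff_cases[OF that] assms(4,5) by (elim disjE) simp_all
  then have "pairing ?p q = 0"
    by (intro orth V_ideal_commute x) (simp only: keys_length_two, blast)
  then show ?thesis by (simp add: pairing_diff_left)
qed

lemma single_outside_in_relation_ideal:
  assumes "x \<in> zlattice r" "snd d \<in> {1..r}" "snd e \<in> {1..r}" "\<not> inside (two_step x d e)"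
  shows "Poly_Mapping.single (two_step x d e) c \<in> T"
proof -
  have "Poly_Mapping.single (two_step x d e) c \<in> leaving_sums (cube_quiver r) X"
    using assms by (simp add: leaving_sums_def)
  with leaving show ?thesis by blast
qed

lemma scale_two_step_sum: "path_scale c (two_step_sum x d e) = Poly_Mapping.single (two_step x d e) c"
  by (simp add: path_scale_def)

lemma relation_ideal_closed:
  "p \<in> T \<Longrightarrow> p' \<in> T \<Longrightarrow> p + p' \<in> T" "p \<in> T \<Longrightarrow> path_scale c p \<in> T" "0 \<in> T"
  using T unfolding path_ideal_def by simp_all

lemma relation_ideal_diff_trans:
  assumes "p - p' \<in> T" "p' - p'' \<in> T"
  shows "p - p'' \<in> T"
  using relation_ideal_closed(1)[OF assms] by simp

text \<open>If both paths stay inside, their commutator is a relation to test against and the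
  coefficients agree, leaving a multiple of the anticommutator. If one path leaves \<open>X\<close>,
  its coefficient can be changed freely modulo \<open>T\<close> until they agree.\<close>

lemma distinct_block_in_relation_ideal:
  assumes x: "x \<in> zlattice r" "snd d \<in> {1..r}" "snd e \<in> {1..r}" "snd d \<noteq> snd e"
  shows "Poly_Mapping.single (two_step x d e) (Poly_Mapping.lookup q (two_step x d e))
       + Poly_Mapping.single (two_step x e d) (Poly_Mapping.lookup q (two_step x e d)) \<in> T"
proof -
  define s s' where "s = two_step x d e" and "s' = two_step x e d"
  define c c' where "c = Poly_Mapping.lookup q s" and "c' = Poly_Mapping.lookup q s'"
  have sum: "Poly_Mapping.single s a + Poly_Mapping.single s' a \<in> T" for a
  proof -
    have "two_step_sum x d e + two_step_sum x e d \<in> T"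
      by (rule subsetD[OF U U_relations_intros(2)[OF x]])
    from relation_ideal_closed(2)[OF this, of a] show ?thesis
      by (simp add: path_scale_simps scale_two_step_sum s_def s'_def)
  qed
  have out: "\<not> inside s \<Longrightarrow> Poly_Mapping.single s a \<in> T" "\<not> inside s' \<Longrightarrow> Poly_Mapping.single s' a \<in> T" for a
    unfolding s_def s'_def using x by (simp_all add: single_outside_in_relation_ideal)
  consider "c = c'" | "\<not> inside s" | "\<not> inside s'"
    unfolding c_def c'_def s_def s'_def using orth_commute[OF x(1-3)] by blast
  then have "Poly_Mapping.single s c + Poly_Mapping.single s' c' \<in> T"
  proof cases
    case 1
    then show ?thesis using sum by simp
  next
    case 2
    have eq: "Poly_Mapping.single s c + Poly_Mapping.single s' c'
        = (Poly_Mapping.single s c' + Poly_Mapping.single s' c') + Poly_Mapping.single s (c - c')"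
      by (simp add: single_diff)
    show ?thesis by (subst eq) (rule relation_ideal_closed(1)[OF sum out(1)[OF 2]])
  next
    case 3
    have eq: "Poly_Mapping.single s c + Poly_Mapping.single s' c'
        = (Poly_Mapping.single s c + Poly_Mapping.single s' c) + Poly_Mapping.single s' (c' - c)"
      by (simp add: single_diff)
    show ?thesis by (subst eq) (rule relation_ideal_closed(1)[OF sum out(2)[OF 3]])
  qed
  then show ?thesis by (simp add: c_def c'_def s_def s'_def)
qed

lemma square_block_in_relation_ideal:
  assumes "x \<in> zlattice r" "snd d \<in> {1..r}"
  shows "Poly_Mapping.single (two_step x d d) c \<in> T"
proof -
  have "two_step_sum x d d \<in> T" by (rule subsetD[OF U U_relations_intros(1)[OF assms]])
  from relation_ideal_closed(2)[OF this, of c] show ?thesis by (simp add: scale_two_step_sum)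
qed

text \<open>The defining relations compare only neighbouring coordinates; the general difference
  telescopes.\<close>

lemma loop_sum_diff_in_relation_ideal:
  assumes x: "x \<in> zlattice r" and "i \<in> {1..r}" "j \<in> {1..r}"
  shows "(loop_sum x i - loop_sum x j :: 'k cube_path_sum) \<in> T"
proof -
  have le: "(loop_sum x m - loop_sum x n :: 'k cube_path_sum) \<in> T" if "1 \<le> m" "m \<le> n" "n \<le> r" for m n
    using that(2,3)
  proof (induction n rule: dec_induct)
    case base
    then show ?case using relation_ideal_closed(3) by simp
  next
    case (step n)
    have "(loop_sum x n - loop_sum x (Suc n) :: 'k cube_path_sum) \<in> T"
      using U U_relations_intros(3)[OF x, of n] step that(1) by auto
    moreover have "(loop_sum x m - loop_sum x n :: 'k cube_path_sum) \<in> T" using step by simp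
    ultimately show ?case using relation_ideal_diff_trans by blast
  qed
  show ?thesis
  proof (cases "i \<le> j")
    case True
    then show ?thesis using le assms by simp
  next
    case False
    then have "loop_sum x j - loop_sum x i \<in> T" using le assms by simp
    from path_ideal_uminus[OF T this] show ?thesis by simp
  qed
qed

text \<open>
  Modulo \<open>T\<close> a combination of the paths at a loop vertex is \<open>\<Sum>\<^sub>i c\<^sub>i (N\<^sub>i + P\<^sub>i)\<close>, which only depends on
  \<open>\<Sum>\<^sub>i c\<^sub>i\<close>. If \<open>X\<close> contains neither neighbour in some direction, then \<open>N\<^sub>i + P\<^sub>i\<close> itself vanishes.
  Otherwise one of \<open>N\<^sub>i\<close>, \<open>P\<^sub>i\<close> can be chosen inside \<open>X\<close> for each \<open>i\<close>; the sum of the chosen paths is a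
  relation of \<open>V\<^sub>X\<close>, and orthogonality to it says \<open>\<Sum>\<^sub>i c\<^sub>i = 0\<close>.
\<close>

lemma loop_block_in_relation_ideal:
  assumes x: "x \<in> zlattice r" and r: "1 \<le> r"
  defines "N \<equiv> \<lambda>i. two_step x (False, i) (True, i)" and "P \<equiv> \<lambda>i. two_step x (True, i) (False, i)"
  shows "(\<Sum>i = 1..r. Poly_Mapping.single (N i) (Poly_Mapping.lookup q (N i))
            + Poly_Mapping.single (P i) (Poly_Mapping.lookup q (P i))) \<in> T"
proof -
  define c where "c i = Poly_Mapping.lookup q (if inside (P i) then P i else N i)" for i
  have comm: "Poly_Mapping.lookup q (N i) = Poly_Mapping.lookup q (P i)"
    if "i \<in> {1..r}" "inside (N i)" "inside (P i)" for i
    using orth_commute[OF x, of "(False, i)" "(True, i)"] that by (simp add: N_def P_def)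
  have out: "\<not> inside (N i) \<Longrightarrow> Poly_Mapping.single (N i) a \<in> T"
      "\<not> inside (P i) \<Longrightarrow> Poly_Mapping.single (P i) a \<in> T" if "i \<in> {1..r}" for i a
    unfolding N_def P_def using that by (simp_all add: single_outside_in_relation_ideal x)
  have N: "Poly_Mapping.single (N i) (Poly_Mapping.lookup q (N i) - c i) \<in> T" if i: "i \<in> {1..r}" for i
  proof (cases "inside (N i)")
    case True
    then have "Poly_Mapping.lookup q (N i) = c i" using comm[OF i] by (simp add: c_def)
    then show ?thesis using relation_ideal_closed(3) by simp
  qed (rule out(1)[OF i])
  have P: "Poly_Mapping.single (P i) (Poly_Mapping.lookup q (P i) - c i) \<in> T" if i: "i \<in> {1..r}" for i
    using out(2)[OF i] relation_ideal_closed(3) by (cases "inside (P i)") (simp_all add: c_def)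
  have loop: "loop_sum x i = Poly_Mapping.single (N i) 1 + Poly_Mapping.single (P i) 1" for i
    by (simp add: N_def P_def)
  have scaled: "(\<Sum>i = 1..r. path_scale (c i) (loop_sum x i)) \<in> T"
  proof (rule sum_weighted_in_path_ideal[OF T _ _ loop_sum_diff_in_relation_ideal[OF x]])
    show "1 \<in> {1..r}" using r by simp
    show "(\<Sum>i = 1..r. c i) = 0 \<or> (\<exists>i\<in>{1..r}. loop_sum x i \<in> T)"
    proof (cases "\<exists>i\<in>{1..r}. \<not> inside (N i) \<and> \<not> inside (P i)")
      case True
      then obtain i where "i \<in> {1..r}" "\<not> inside (N i)" "\<not> inside (P i)" by blast
      then have "loop_sum x i \<in> T" unfolding loop using out relation_ideal_closed(1) by blast
      with \<open>i \<in> {1..r}\<close> show ?thesis by blast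
    next
      case False
      define p :: "'k cube_path_sum" where
        "p = (\<Sum>i = 1..r. Poly_Mapping.single (if inside (P i) then P i else N i) 1)"
      \<comment> \<open>Exchanging \<open>N i\<close> for \<open>P i\<close> adds the commutator
        \<open>P i - N i\<close>, so \<open>p\<close> differs from the defining sum relation of
        \<open>V_ideal r\<close> only by elements of that ideal.\<close>
      have "p = (\<Sum>i = 1..r. Poly_Mapping.single (N i) 1)
          + (\<Sum>i = 1..r. if inside (P i) then Poly_Mapping.single (P i) 1 - Poly_Mapping.single (N i) 1 else 0)"
        unfolding p_def sum.distrib[symmetric] by (intro sum.cong refl) simp
      also have "\<dots> \<in> V_ideal r"
      proof -
        have V0: "(0 :: 'k cube_path_sum) \<in> V_ideal r" "\<And>a b :: 'k cube_path_sum. a \<in> V_ideal r \<Longrightarrow> b \<in> V_ideal r \<Longrightarrow> a + b \<in> V_ideal r"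
          using path_ideal_V[of r, where 'a = 'k] unfolding path_ideal_def by simp_all
        have "(if inside (P i) then Poly_Mapping.single (P i) 1 - Poly_Mapping.single (N i) 1 else 0 :: 'k cube_path_sum)
            \<in> V_ideal r" if "i \<in> {1..r}" for i
        proof -
          have "(Poly_Mapping.single (P i) 1 - Poly_Mapping.single (N i) 1 :: 'k cube_path_sum) \<in> V_ideal r"
            unfolding P_def N_def by (rule V_ideal_commute[OF x]) (use that in simp_all)
          then show ?thesis using V0(1) by simp
        qed
        then show ?thesis
          using V_ideal_sum[OF x, where 'a = 'k]
          by - (rule V0(2)[OF _ path_ideal_sum[OF path_ideal_V]]; simp add: N_def)
      qed
      finally have pV: "p \<in> V_ideal r" .
      have "inside s \<and> length (fst (snd s)) = 2" if s: "s \<in> Poly_Mapping.keys p" for s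
      proof -
        from s obtain i where "i \<in> {1..r}" "s = (if inside (P i) then P i else N i)"
          unfolding p_def using keys_sum[of "\<lambda>i. Poly_Mapping.single (if inside (P i) then P i else N i) (1::'k)" "{1..r}"]
          by fastforce
        with False show ?thesis by (auto simp: P_def N_def simp del: split_paired_All split_paired_Ex)
      qed
      then have "pairing p q = 0" by (intro orth pV) (simp only: keys_length_two, blast)
      then show ?thesis by (simp add: p_def pairing_sum_left c_def)
    qed
  qed simp
  have "(\<Sum>i = 1..r. Poly_Mapping.single (N i) (Poly_Mapping.lookup q (N i))
            + Poly_Mapping.single (P i) (Poly_Mapping.lookup q (P i)))
      = (\<Sum>i = 1..r. path_scale (c i) (loop_sum x i))
        + (\<Sum>i = 1..r. Poly_Mapping.single (N i) (Poly_Mapping.lookup q (N i) - c i)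
            + Poly_Mapping.single (P i) (Poly_Mapping.lookup q (P i) - c i))"
    unfolding sum.distrib[symmetric]
    by (intro sum.cong refl) (simp add: path_scale_simps scale_two_step_sum N_def P_def single_diff)
  also have "\<dots> \<in> T"
    by (rule relation_ideal_closed(1)[OF scaled path_ideal_sum[OF T relation_ideal_closed(1)[OF N P]]])
  finally show ?thesis .
qed

lemma orthogonal_keys:
  assumes "s \<in> Poly_Mapping.keys q"
  obtains x d e where "s = two_step x d e" "x \<in> zlattice r" "snd d \<in> {1..r}" "snd e \<in> {1..r}"
proof -
  have "s \<in> paths (cube_quiver r)" "length (fst (snd s)) = 2"
    using assms q X wf_digraph.paths_restrict_subset[OF wf_cube_quiver, of X r] by auto
  then show thesis using that by (rule path_length_two)
qed

text \<open>The support of \<open>q\<close> may meet only part of a block. Padding by paths with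
  coefficient 0 (\<open>block\<close>) completes it to the full set of paths treated by the square,
  distinct or loop lemma.\<close>

lemma label_block_in_relation_ideal:
  assumes s: "s \<in> Poly_Mapping.keys q"
  shows "(\<Sum>t | t \<in> Poly_Mapping.keys q \<and> label t = label s. Poly_Mapping.single t (Poly_Mapping.lookup q t)) \<in> T"
proof -
  let ?B = "{t. t \<in> Poly_Mapping.keys q \<and> label t = label s}"
  let ?f = "\<lambda>t. Poly_Mapping.single t (Poly_Mapping.lookup q t)"
  have block: "sum ?f ?B = sum ?f A"
    if A: "finite A" "?B \<subseteq> A" "\<And>t. t \<in> A \<Longrightarrow> label t = label s" for A
    by (rule sum.mono_neutral_left) (use A in \<open>auto simp: in_keys_iff\<close>)
  obtain x d e where xde: "s = two_step x d e" "x \<in> zlattice r" "snd d \<in> {1..r}" "snd e \<in> {1..r}"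
    using s by (rule orthogonal_keys)
  consider (square) "d = e" | (distinct) "snd d \<noteq> snd e" | (loop) "snd d = snd e" "d \<noteq> e" by blast
  then show ?thesis
  proof cases
    case square
    have "sum ?f ?B = sum ?f {s}"
    proof (rule block)
      show "?B \<subseteq> {s}"
      proof
        fix t assume "t \<in> ?B"
        then have t: "t \<in> Poly_Mapping.keys q" "label t = label s" by simp_all
        obtain y d' e' where "t = two_step y d' e'" using t(1) by (rule orthogonal_keys)
        with t(2) show "t \<in> {s}"
          unfolding xde(1) square by (simp add: label_two_step split: if_splits)
      qed
    qed simp_all
    then show ?thesis using square_block_in_relation_ideal[OF xde(2,3)] unfolding xde(1) square by simp
  next
    case distinct
    have "sum ?f ?B = sum ?f {two_step x d e, two_step x e d}"
    proof (rule block)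
      show "?B \<subseteq> {two_step x d e, two_step x e d}"
      proof
        fix t assume "t \<in> ?B"
        then have t: "t \<in> Poly_Mapping.keys q" "label t = label s" by simp_all
        obtain y d' e' where "t = two_step y d' e'" using t(1) by (rule orthogonal_keys)
        with t(2) distinct show "t \<in> {two_step x d e, two_step x e d}"
          unfolding xde(1) by (simp add: label_two_step doubleton_eq_iff split: if_splits)
      qed
    qed (use distinct in \<open>auto simp: xde(1) label_two_step simp del: split_paired_All\<close>)
    moreover have "two_step x d e \<noteq> two_step x e d" using distinct by auto
    ultimately show ?thesis using distinct_block_in_relation_ideal[OF xde(2-4) distinct] by simp
  next
    case loop
    define N P where "N i = two_step x (False, i) (True, i)" and "P i = two_step x (True, i) (False, i)" for i
    have "sum ?f ?B = sum ?f (N ` {1..r} \<union> P ` {1..r})"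
    proof (rule block)
      show "?B \<subseteq> N ` {1..r} \<union> P ` {1..r}"
      proof
        fix t assume "t \<in> ?B"
        then have t: "t \<in> Poly_Mapping.keys q" "label t = label s" by simp_all
        obtain y d' e' where y: "t = two_step y d' e'" "snd d' \<in> {1..r}" using t(1) by (rule orthogonal_keys)
        with t(2) loop have yx: "y = x" "snd d' = snd e'" "d' \<noteq> e'"
          unfolding xde(1) by (simp_all add: label_two_step split: if_splits)
        obtain b i b' where "d' = (b, i)" "e' = (b', i)" using yx(2) by (metis prod.collapse)
        with y yx show "t \<in> N ` {1..r} \<union> P ` {1..r}"
          by (cases b) (simp_all add: N_def P_def image_iff)
      qed
      show "label t = label s" if "t \<in> N ` {1..r} \<union> P ` {1..r}" for t
        using that loop unfolding xde(1) N_def P_def by (elim UnE imageE) (simp_all add: label_two_step)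
    qed simp
    also have "\<dots> = (\<Sum>i = 1..r. ?f (N i) + ?f (P i))"
    proof -
      have "inj_on N {1..r}" "inj_on P {1..r}" "N ` {1..r} \<inter> P ` {1..r} = {}"
        by (auto simp: N_def P_def inj_on_def)
      then show ?thesis by (simp add: sum.union_disjoint sum.reindex sum.distrib)
    qed
    also have "\<dots> \<in> T" unfolding N_def P_def by (rule loop_block_in_relation_ideal) (use xde in auto)
    finally show ?thesis .
  qed
qed

lemma orthogonal_in_relation_ideal: "q \<in> T"
proof -
  let ?f = "\<lambda>t. Poly_Mapping.single t (Poly_Mapping.lookup q t)"
  have "q = (\<Sum>s\<in>Poly_Mapping.keys q. ?f s)" by (simp add: poly_mapping_sum_singles)
  also have "\<dots> = (\<Sum>y\<in>label ` Poly_Mapping.keys q. sum ?f {t. t \<in> Poly_Mapping.keys q \<and> label t = y})"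
    by (rule sum.image_gen) simp
  also have "\<dots> \<in> T"
    by (rule path_ideal_sum[OF T]) (use label_block_in_relation_ideal in blast)
  finally show ?thesis .
qed

end

section \<open>Matching the two presentations over the full subquiver on \<open>X\<close>\<close>

theorem theorem53:
  fixes r :: nat and X :: "(nat \<Rightarrow> int) set"
  assumes "1 \<le> r"
    and "cubist r X"
  shows "graded_isomorphic
           (V_cubist_dual r X :: ('k::field, 'k cube_path_sum set) graded_alg)
           (U_cubist r X)"
proof -
  let ?G = "cube_quiver r"
  let ?R = "quadratic_relations (?G \<restriction> X) (V_class r) (V_cubist r X) :: 'k cube_path_sum set"
  let ?O = "orthogonal_complement (?G \<restriction> X) ?R"
  let ?W = "{(u, w, v) \<in> paths (?G \<restriction> X). length w = 2}"
  interpret wf_digraph ?G by (rule wf_cube_quiver)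
  have X: "X \<subseteq> verts ?G" using cubist_subset[OF assms(2)] by simp
  have U_keys: "\<forall>u\<in>U_relations r :: 'k cube_path_sum set. Poly_Mapping.keys u \<subseteq> paths ?G"
    by (metis U_relations_keys subsetI)
  \<comment> \<open>This is \<open>W \<inter> A\<close>: a degree-two element supported inside
    \<open>X\<close> is zero in the corner algebra exactly when it is zero in the quotient by
    \<open>V_ideal r\<close>.\<close>
  have R: "?R = {p \<in> V_ideal r. Poly_Mapping.keys p \<subseteq> ?W}"
  proof -
    have "V_class r p = gzero (V_cubist r X) \<longleftrightarrow> p \<in> V_ideal r" for p :: "'k cube_path_sum"
    proof -
      have "gzero (V_cubist r X) = V_class r (0 :: 'k cube_path_sum)"
        by (simp add: V_cubist_def corner_alg_def Let_def V_class_ops)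
      then show ?thesis
        using path_coset_eq_iff[OF path_ideal_V, of r p 0] by (simp add: V_class_def)
    qed
    then show ?thesis by (auto simp: quadratic_relations_def)
  qed
  have O: "?O = {q. Poly_Mapping.keys q \<subseteq> ?W \<and> (\<forall>p\<in>?R. pairing p q = 0)}"
    by (simp add: orthogonal_complement_def pairing_def)
  have J: "path_ideal (?G \<restriction> X) (ideal_gen (path_algebra (?G \<restriction> X)) ?O)"
    by (rule path_ideal_gen) (auto simp: O)
  have U_O: "restrict_sum ?G X u \<in> ?O" if u: "u \<in> U_relations r" for u
  proof -
    \<comment> \<open>Dropping leaving paths from \<open>u\<close> is invisible to a
      \<open>p\<close> supported inside \<open>X\<close>, so orthogonality of \<open>u\<close>
      passes to its projection.\<close>
    have "pairing p (restrict_sum ?G X u) = pairing p u" if "Poly_Mapping.keys p \<subseteq> ?W" for p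
      unfolding pairing_def
      by (rule sum.cong) (use that in \<open>auto simp: lookup_restrict_sum when_def\<close>)
    moreover have "length (fst (snd s)) = 2" if "s \<in> Poly_Mapping.keys u" for s
      using U_relations_keys[OF u] that by metis
    then have "Poly_Mapping.keys (restrict_sum ?G X u) \<subseteq> ?W"
      unfolding keys_restrict_sum by auto
    ultimately show ?thesis
      unfolding O unfolding R using pairing_V_ideal[OF _ u] by simp
  qed
  define T :: "'k cube_path_sum set" where
    "T = {x + z | x z. x \<in> U_ideal r \<and> z \<in> leaving_sums ?G X}"
  have mem_T: "x + z \<in> T" if "x \<in> U_ideal r" "z \<in> leaving_sums ?G X" for x z
    unfolding T_def using that by blast
  have U: "path_ideal ?G (U_ideal r :: 'k cube_path_sum set)"
    unfolding U_ideal_def by (rule path_ideal_gen[OF U_keys])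
  have T: "path_ideal ?G T"
    unfolding T_def by (rule path_ideal_plus[OF U path_ideal_leaving_sums])
  have U_T: "U_relations r \<subseteq> T"
  proof
    fix u :: "'k cube_path_sum" assume "u \<in> U_relations r"
    then have "u \<in> U_ideal r" unfolding U_ideal_def by (rule ideal_gen.base)
    from mem_T[OF this, of 0] show "u \<in> T" by (simp add: leaving_sums_def)
  qed
  have Z_T: "leaving_sums ?G X \<subseteq> T"
    using mem_T[of 0] U by (auto simp: path_ideal_def)
  \<comment> \<open>Only the generators need the block analysis; since \<open>T\<close> is an ideal
    of the large path algebra, it also absorbs multiplication by elements of the small one.\<close>
  have J_T: "x \<in> T" if "x \<in> ideal_gen (path_algebra (?G \<restriction> X)) ?O" for x
    using that
  proof induction
    case zero
    then show ?case using T by (simp add: path_ideal_def)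
  next
    case (base q)
    then have "Poly_Mapping.keys q \<subseteq> ?W" "\<forall>p\<in>?R. pairing p q = 0" unfolding O by simp_all
    then show ?case
      by (intro orthogonal_in_relation_ideal[OF _ T U_T Z_T]) (use X R in simp_all)
  next
    case (add x y)
    then show ?case using T by (simp add: path_ideal_def)
  next
    case (scale x c)
    then show ?case using T by (simp add: path_ideal_def)
  next
    case (left a x)
    then have "Poly_Mapping.keys a \<subseteq> paths ?G" using paths_restrict_subset[OF X] by auto
    with left show ?case using T by (simp add: path_ideal_def)
  next
    case (right a x)
    then have "Poly_Mapping.keys a \<subseteq> paths ?G" using paths_restrict_subset[OF X] by auto
    with right show ?case using T by (simp add: path_ideal_def)
  qed
  have "U_cubist r X = quotient_alg (quotient_alg (path_algebra ?G) (U_ideal r))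
      (coset (path_algebra ?G) (U_ideal r) ` (leaving_sums ?G X :: 'k cube_path_sum set))"
    unfolding lin_span_outside_idempotents[OF U, symmetric]
    by (simp add: U_cubist_def U_alg_def U_class_def vertex_def)
  moreover have "graded_isomorphic (V_cubist_dual r X)
      (quotient_alg (quotient_alg (path_algebra ?G) (U_ideal r))
        (coset (path_algebra ?G) (U_ideal r) ` (leaving_sums ?G X :: 'k cube_path_sum set)))"
    unfolding V_cubist_dual_def quadratic_dual_def U_ideal_def
  proof (rule restricted_presentation[OF X U_keys J])
    show "restrict_sum ?G X ` U_relations r \<subseteq> ideal_gen (path_algebra (?G \<restriction> X)) ?O"
      using U_O by (blast intro: ideal_gen.base)
    show "ideal_gen (path_algebra (?G \<restriction> X)) ?O
        \<subseteq> {x + z | x z. x \<in> ideal_gen (path_algebra ?G) (U_relations r) \<and> z \<in> leaving_sums ?G X}"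
      unfolding U_ideal_def[symmetric] T_def[symmetric] using J_T by (rule subsetI)
  qed
  ultimately show ?thesis by simp
qed

end
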